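(* Let $n\ge 1$ and $c_n:=\dfrac{4^{n}(n!)^2}{(2n-1)!}$. 1) For any closed complex Euclidean ball $\mathbb{B}\subset\mathbb{C}^n$ and any $u\in\mathcal{L}(\mathbb{C}^n)$ with $\max_{\mathbb{B}}u=0$, $$\frac{\lambda_{2n}(\{z\in\mathbb{B}:u(z)\le -s\})}{\lambda_{2n}(\mathbb{B})}\le c_n\,e^{-2s},\qquad \forall s>0.$$ 2) Let $\mathbb{G}\subset\mathbb{C}^n$ be a generic real subspace of complex dimension $m\le n-1$. Then for any real Euclidean closed ball $B\subset\mathbb{G}$ and any $u\in\mathcal{L}(\mathbb{C}^n)$ with $\max_{B}u=0$, $$\frac{\lambda_{n+m}(\{z\in B:u(z)\le -s\})}{\lambda_{n+m}(B)}\le 8(n+m)\,e^{-s},\qquad \forall s>0.$$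
   Context: $\mathcal{L}(\mathbb{C}^n)$ is the Lelong class: the set of plurisubharmonic functions $u$ on $\mathbb{C}^n$ (not identically $-\infty$) with $\sup_{z\in\mathbb{C}^n}\{u(z)-\log^+|z|\}<+\infty$. A real linear subspace $\mathbb{G}\subset\mathbb{C}^n$ is generic if $\mathbb{G}+J\mathbb{G}=\mathbb{C}^n$, where $J$ is the complex structure (multiplication by $i$). Its complex dimension is $m:=\dim_{\mathbb{C}}(\mathbb{G}\cap J\mathbb{G})$, so $\dim_{\mathbb{R}}\mathbb{G}=n+m$. $\mathbb{G}$ carries the induced Euclidean structure with Lebesgue measure $\lambda_{n+m}$; $\lambda_{2n}$ is Lebesgue measure on $\mathbb{C}^n$. Balls have positive radius. *)

theory Defs
  imports "HOL-Analysis.Analysis"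
begin

definition usc :: "('a::topological_space \<Rightarrow> ereal) \<Rightarrow> bool" where
  "usc u \<longleftrightarrow> (\<forall>c. open {z. u z < c})"

(* Extended-valued mean over a circle.  e2ennreal truncates negative values to 0, so the two
   integrals are those of the positive and of the negative part of u.  For an upper
   semicontinuous u < \<infinity> the first one is finite, so \<infinity> - \<infinity> does not occur. *)
definition circle_mean :: "(complex \<Rightarrow> ereal) \<Rightarrow> complex \<Rightarrow> real \<Rightarrow> ereal" where
  "circle_mean u c r =
     (enn2ereal (\<integral>\<^sup>+t\<in>{0..2 * pi}. e2ennreal (u (c + of_real r * cis t)) \<partial>lborel)
      - enn2ereal (\<integral>\<^sup>+t\<in>{0..2 * pi}. e2ennreal (- u (c + of_real r * cis t)) \<partial>lborel))
     / ereal (2 * pi)"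

(* The constant function -\<infinity> is allowed here and in psh below. *)
definition subharmonic :: "(complex \<Rightarrow> ereal) \<Rightarrow> bool" where
  "subharmonic u \<longleftrightarrow> usc u \<and> (\<forall>z. u z < \<infinity>) \<and> (\<forall>c. \<forall>r>0. u c \<le> circle_mean u c r)"

definition psh :: "(complex ^ 'n \<Rightarrow> ereal) \<Rightarrow> bool" where
  "psh u \<longleftrightarrow> usc u \<and> (\<forall>z. u z < \<infinity>) \<and> (\<forall>a b. subharmonic (\<lambda>\<zeta>. u (a + \<zeta> *s b)))"

(* Since ln 0 = 0 in the library, the value at 0 is 0, as it should be. *)
definition log_plus :: "real \<Rightarrow> real" where
  "log_plus x = max 0 (ln x)"

definition lelong :: "(complex ^ 'n \<Rightarrow> ereal) set" where
  "lelong = {u. psh u \<and> (\<exists>z. u z \<noteq> -\<infinity>) \<and> (SUP z. u z - ereal (log_plus (norm z))) < \<infinity>}"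

definition has_max_on :: "('a \<Rightarrow> ereal) \<Rightarrow> 'a set \<Rightarrow> ereal \<Rightarrow> bool" where
  "has_max_on u B M \<longleftrightarrow> (\<exists>z\<in>B. u z = M) \<and> (\<forall>z\<in>B. u z \<le> M)"

definition J :: "complex ^ 'n \<Rightarrow> complex ^ 'n" where
  "J z = \<i> *s z"

definition generic :: "(complex ^ 'n) set \<Rightarrow> bool" where
  "generic G \<longleftrightarrow> {x + y |x y. x \<in> G \<and> y \<in> J ` G} = UNIV"

(* vec.dim is the dimension over the scalar field of the vectors, here \<complex>. *)
definition complex_dim :: "(complex ^ 'n) set \<Rightarrow> nat" where
  "complex_dim G = vec.dim (G \<inter> J ` G)"

definition orthonormal_basis_of :: "'a::euclidean_space set \<Rightarrow> 'a set \<Rightarrow> bool" where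
  "orthonormal_basis_of E G \<longleftrightarrow>
     E \<subseteq> G \<and> pairwise orthogonal E \<and> (\<forall>b\<in>E. norm b = 1) \<and> span E = G"

lemma orthonormal_basis_of_SOME:
  assumes "subspace G"
  shows "orthonormal_basis_of (SOME E. orthonormal_basis_of E G) G"
proof -
  have "\<exists>E. orthonormal_basis_of E G"
    using orthonormal_basis_subspace[OF assms] unfolding orthonormal_basis_of_def by metis
  then show ?thesis by (rule someI_ex)
qed

(* Lebesgue measure of dimension dim G of a real linear subspace G, as a measure on the ambient
   space concentrated on G: the construction of lborel in the library, with Basis replaced by an
   orthonormal basis of G.  By invariance of Lebesgue measure under orthogonal maps the result
   does not depend on the basis chosen. *)
definition subspace_lebesgue :: "'a::euclidean_space set \<Rightarrow> 'a measure" where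
  "subspace_lebesgue G =
     (let E = (SOME E. orthonormal_basis_of E G)
      in distr (\<Pi>\<^sub>M b\<in>E. (lborel :: real measure)) borel (\<lambda>f. \<Sum>b\<in>E. f b *\<^sub>R b))"

end

(* Everything reduces to one-variable estimates on slices through a point z0 where u(z0) = 0.

   In one variable, let K be a compact subset of {u <= -s} and let F be holomorphic off K with
   |F| <= 1 and F = O(1/z) at infinity.  The maximum principle applied to u + s + log |F| gives
   u <= -s - log |F| off K.  For a plane set K, F is the Cauchy transform of K divided by its
   Ahlfors-Beurling bound sqrt (pi area K); for a set on the real line, F = tanh (I / 4) with I the
   Cauchy transform of length, whose imaginary part lies in (-pi, pi).  Evaluating at z0, which
   lies on the boundary of the disc or at an end point of the segment, bounds the area of K by
   4 pi r^2 e^(-2s) in a disc of radius r, and its length by 8 l e^(-s) in a segment of length l.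

   These bounds are integrated over the complex lines (respectively real half-lines) through z0.
   The ball and the sublevel set are sliced in the same way, so that the normalising constants of
   polar coordinates cancel: only the integral of |z|^(2n-2) over a disc with 0 on its boundary
   has to be computed.  In the complex case the maximum principle puts z0 on the sphere. *)
theory Submission
  imports Defs "HOL-Complex_Analysis.Complex_Analysis"
begin

subsection \<open>Maximum principle for subharmonic functions of logarithmic growth\<close>

text \<open>The function -log |F| takes the place of the Green function of the complement of K with
  pole at infinity. It grows there at least like log |z| up to a constant, and this matches the
  coefficient 1 of the logarithm in the Lelong class. The additive constant in the growth of u
  varies with the slice, but it never enters the bounds. Taking all slices through one point where u
  vanishes normalises them all at once and excludes slices on which u is identically minus infinity.

  The constants come from a crude comparison on each slice. In a disc of radius r with 0 on its
  boundary |z| <= 2 r, so the area bound gives K the weighted measure at most 4^n pi r^(2n) e^(-2s);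
  the disc itself has r^(2n) times the moment pi (2n-1)! / (n!)^2, and c_n is the quotient. On a
  segment of length l in dimension d the weight t^(d-1) is at most l^(d-1), while its integral is
  l^d / d; this gives 8 d e^(-s), and d <= n + m.\<close>

lemma usc_borel_measurable:
  assumes "usc u"
  shows "u \<in> borel_measurable borel"
  using assms unfolding usc_def borel_measurable_ereal_iff_Iio
  by (auto simp: vimage_def)

text \<open>Continuity of \<open>q\<close> is asked on \<open>Z\<close> alone because later
  penalties contain log |F|, which is continuous only off \<open>K\<close> and off the zeros of
  \<open>F\<close>. Without a maximum, every point of \<open>Z\<close> would have a neighbourhood on
  which u - q stays below some value taken in \<open>Z\<close>; the largest of the finitely many
  values from a subcover is taken at a point that is itself covered, a contradiction.\<close>

lemma usc_diff_attains_max: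
  fixes u :: "'a::t2_space \<Rightarrow> ereal" and q :: "'a \<Rightarrow> real"
  assumes u: "usc u" and Z: "compact Z" "Z \<noteq> {}" and q: "continuous_on Z q"
  shows "\<exists>z\<in>Z. \<forall>w\<in>Z. u w - ereal (q w) \<le> u z - ereal (q z)"
proof (rule ccontr)
  define v where "v = (\<lambda>w. u w - ereal (q w))"
  assume "\<not> ?thesis"
  then have no_max: "\<exists>y\<in>Z. v x < v y" if "x \<in> Z" for x
    using that unfolding v_def by (meson not_le)
  have "\<exists>T y. open T \<and> x \<in> T \<and> y \<in> Z \<and> (\<forall>z\<in>T \<inter> Z. v z < v y)" if x: "x \<in> Z" for x
  proof -
    obtain y where y: "y \<in> Z" "v x < v y" using no_max x by blast
    obtain d where d: "v x < ereal d" "ereal d < v y" using y(2) ereal_dense2 by blast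
    have "u x < ereal (d + q x)" using d(1) by (cases "u x") (auto simp: v_def)
    \<comment> \<open>The room between u x and d + q x is shared out: semicontinuity keeps u below
      e, continuity keeps q above e - d, so u - q stays below d.\<close>
    then obtain e where e: "u x < ereal e" "ereal e < ereal (d + q x)" using ereal_dense2 by blast
    have "(q \<longlongrightarrow> q x) (at x within Z)" using q x by (auto simp: continuous_on_def)
    then have "\<forall>\<^sub>F z in at x within Z. e - d < q z"
      by (rule order_tendstoD) (use e(2) in auto)
    then obtain S where S: "open S" "x \<in> S" "\<And>z. z \<in> S \<Longrightarrow> z \<noteq> x \<Longrightarrow> z \<in> Z \<Longrightarrow> e - d < q z"
      unfolding eventually_at_topological by blast
    have "v z < v y" if "z \<in> (S \<inter> {z. u z < ereal e}) \<inter> Z" for z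
    proof -
      have "e - d < q z" using S(3)[of z] that e(2) by (cases "z = x") auto
      then have "v z < ereal d" using that by (cases "u z") (auto simp: v_def)
      then show ?thesis using d(2) by simp
    qed
    moreover have "open (S \<inter> {z. u z < ereal e})" using S(1) u by (auto simp: usc_def)
    ultimately show ?thesis using S(2) e(1) y(1) by (intro exI[of _ "S \<inter> {z. u z < ereal e}"]) blast
  qed
  then have "\<forall>x\<in>Z. \<exists>Ty. open (fst Ty) \<and> x \<in> fst Ty \<and> snd Ty \<in> Z \<and> (\<forall>z\<in>fst Ty \<inter> Z. v z < v (snd Ty))"
    by fastforce
  then obtain Ty where Ty: "\<And>x. x \<in> Z \<Longrightarrow> open (fst (Ty x))" "\<And>x. x \<in> Z \<Longrightarrow> x \<in> fst (Ty x)"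
      "\<And>x. x \<in> Z \<Longrightarrow> snd (Ty x) \<in> Z" "\<And>x z. x \<in> Z \<Longrightarrow> z \<in> fst (Ty x) \<Longrightarrow> z \<in> Z \<Longrightarrow> v z < v (snd (Ty x))"
    unfolding bchoice_iff by blast
  define T where "T x = fst (Ty x)" for x
  define y where "y x = snd (Ty x)" for x
  note Ty = Ty[folded T_def y_def]
  obtain D where D: "D \<subseteq> Z" "finite D" "Z \<subseteq> (\<Union>x\<in>D. T x)"
    proof (rule compactE_image[OF Z(1), of Z T])
    show "open (T x)" if "x \<in> Z" for x using Ty(1) that .
    show "Z \<subseteq> (\<Union>x\<in>Z. T x)" using Ty(2) by (intro subsetI UN_I)
  qed (use that in blast)
  have "D \<noteq> {}" using D(3) Z(2) by auto
  then have "Max ((\<lambda>x. v (y x)) ` D) \<in> (\<lambda>x. v (y x)) ` D" using D(2) by (intro Max_in) auto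
  then obtain x0 where x0: "x0 \<in> D" "Max ((\<lambda>x. v (y x)) ` D) = v (y x0)" by (elim imageE)
  have max: "v (y x) \<le> v (y x0)" if "x \<in> D" for x
    unfolding x0(2)[symmetric] using D(2) that by (intro Max_ge) auto
  obtain x where "x \<in> D" "y x0 \<in> T x" using D(1,3) x0(1) Ty(3)[of x0] by blast
  then have "v (y x0) < v (y x)" using Ty(3)[of x0] Ty(4)[of x "y x0"] D(1) x0(1) by blast
  then show False using max[OF \<open>x \<in> D\<close>] by simp
qed

lemma circle_mean_value:
  assumes r: "r > 0" and G: "G holomorphic_on cball c r"
  shows "((\<lambda>t. Re (G (c + of_real r * cis t))) has_integral 2 * pi * Re (G c)) {0..2 * pi}"
proof -
  have "((\<lambda>w. G w / (w - c)) has_contour_integral 2 * of_real pi * \<i> * G c) (part_circlepath c r 0 (2 * pi))"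
    using Cauchy_integral_circlepath_simple[OF G, of c] r by (simp add: circlepath_def)
  then have "((\<lambda>t. G (c + r * cis t) / (c + r * cis t - c) * r * \<i> * cis t)
      has_integral 2 * of_real pi * \<i> * G c) {0..2 * pi}"
    by (subst (asm) has_contour_integral_part_circlepath_iff) auto
  also have "(\<lambda>t. G (c + r * cis t) / (c + r * cis t - c) * r * \<i> * cis t) = (\<lambda>t. \<i> * G (c + r * cis t))"
    using r by (auto simp: field_simps)
  finally show ?thesis
    by (auto dest: has_integral_linear[OF _ bounded_linear_Im] simp: o_def)
qed

text \<open>The harmonic majorant is presented as the real part of a holomorphic function because
  Cauchy's formula then gives its circle mean.\<close>

lemma subharmonic_le_Re_holomorphic:
  assumes sub: "subharmonic u" and r: "r > 0" and G: "G holomorphic_on cball c r"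
    and le: "\<And>w. w \<in> sphere c r \<Longrightarrow> u w \<le> ereal (Re (G w))"
  shows "u c \<le> ereal (Re (G c))"
proof -
  define I where "I = {0..2 * pi}"
  define p where "p = (\<lambda>t. c + of_real r * cis t)"
  define q where "q = (\<lambda>t. Re (G (p t)) * indicator I t)"
  have p_sphere: "p t \<in> sphere c r" for t
    using r by (auto simp: p_def dist_norm norm_mult)
  have cont_p: "continuous_on A p" for A
    unfolding p_def by (intro continuous_intros)
  have "continuous_on I (\<lambda>t. Re (G (p t)))"
    using p_sphere r
    by (intro continuous_intros continuous_on_compose2[OF holomorphic_on_imp_continuous_on[OF G] cont_p]) auto
  then have int: "set_integrable lborel I (\<lambda>t. Re (G (p t)))"
    unfolding I_def by (rule borel_integrable_atLeastAtMost')
  then have intq: "integrable lborel q"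
    by (simp add: q_def set_integrable_def mult.commute)
  then have q_meas [measurable]: "q \<in> borel_measurable lborel" by simp
  have "integral\<^sup>L lborel q = integral I (\<lambda>t. Re (G (p t)))"
    using set_borel_integral_eq_integral(2)[OF int]
    by (simp add: set_lebesgue_integral_def q_def mult.commute)
  also have "\<dots> = 2 * pi * Re (G c)"
    using circle_mean_value[OF r G] by (simp add: integral_unique I_def p_def)
  finally have mean: "integral\<^sup>L lborel q = 2 * pi * Re (G c)" .
  define P where "P = (\<integral>\<^sup>+t. ennreal (q t) \<partial>lborel)"
  define N where "N = (\<integral>\<^sup>+t. ennreal (- q t) \<partial>lborel)"
  define U where "U = (\<integral>\<^sup>+t\<in>I. e2ennreal (u (p t)) \<partial>lborel)"
  define W where "W = (\<integral>\<^sup>+t\<in>I. e2ennreal (- u (p t)) \<partial>lborel)"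
  have PN: "P < \<infinity>" "N < \<infinity>"
    using intq by (auto simp: P_def N_def real_integrable_def less_top)
  have PN_mean: "enn2real P - enn2real N = 2 * pi * Re (G c)"
    using mean real_lebesgue_integral_def[OF intq] by (simp add: P_def N_def)
  have u_meas [measurable]: "u \<in> borel_measurable borel"
    using sub by (auto simp: subharmonic_def intro: usc_borel_measurable)
  have p_meas [measurable]: "p \<in> borel_measurable borel"
    using cont_p[of UNIV] by (rule borel_measurable_continuous_onI)
  have [measurable]: "I \<in> sets borel" by (simp add: I_def)
  have uq: "u (p t) \<le> ereal (q t)" if "t \<in> I" for t
    using le[OF p_sphere] that by (simp add: q_def)
  \<comment> \<open>The integral of the negative part of u may be infinite, so u <= q is integrated
    in the additive form u+ + q- <= u- + q+, and no difference is taken before the end.\<close>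
  have "U + N \<le> W + P"
  proof -
    have "U + N = (\<integral>\<^sup>+t. e2ennreal (u (p t)) * indicator I t + ennreal (- q t) \<partial>lborel)"
      unfolding U_def N_def by (rule nn_integral_add[symmetric]) measurable
    also have "\<dots> \<le> (\<integral>\<^sup>+t. e2ennreal (- u (p t)) * indicator I t + ennreal (q t) \<partial>lborel)"
    proof (rule nn_integral_mono)
      fix t
      show "e2ennreal (u (p t)) * indicator I t + ennreal (- q t)
          \<le> e2ennreal (- u (p t)) * indicator I t + ennreal (q t)"
      proof (cases "t \<in> I")
        case True
        then have "u (p t) \<le> ereal (q t)" by (rule uq)
        then show ?thesis
        proof (cases "u (p t)")
          case (real x)
          then have "ennreal x + ennreal (- q t) \<le> ennreal (- x) + ennreal (q t)"
            using uq[OF True]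
            by (cases "x \<ge> 0"; cases "q t \<ge> 0") (auto simp: ennreal_neg intro: ennreal_leI)
          then show ?thesis using True real by simp
        qed (auto simp: True e2ennreal_neg)
      qed (auto simp: q_def)
    qed
    also have "\<dots> = W + P"
      unfolding W_def P_def by (rule nn_integral_add) measurable
    finally show ?thesis .
  qed
  \<comment> \<open>If \<open>W\<close> is infinite, the previous inequality says nothing; this one
    makes \<open>U\<close> finite, so that U - W is minus infinity and not an indeterminate
    difference.\<close>
  moreover have "U \<le> P"
    unfolding U_def P_def
  proof (rule nn_integral_mono)
    fix t show "e2ennreal (u (p t)) * indicator I t \<le> ennreal (q t)"
      using uq[of t] e2ennreal_mono[of "u (p t)" "ereal (q t)"]
      by (auto simp: q_def split: split_indicator)
  qed
  ultimately have "enn2ereal U - enn2ereal W \<le> ereal (enn2real P - enn2real N)"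
    using PN
    by (cases U; cases W; cases P; cases N)
       (auto simp: ennreal_plus[symmetric] enn2ereal_ennreal top_ennreal.rep_eq top_unique simp del: ennreal_plus)
  then have "(enn2ereal U - enn2ereal W) / ereal (2 * pi) \<le> ereal (2 * pi * Re (G c)) / ereal (2 * pi)"
    unfolding PN_mean by (rule ereal_divide_right_mono) auto
  moreover have "u c \<le> circle_mean u c r" using sub r by (auto simp: subharmonic_def)
  ultimately show ?thesis by (simp add: circle_mean_def U_def W_def I_def p_def)
qed

(* The exponent 1 + epsilon on F forces u + s + (1 + epsilon) log |F| to tend to minus infinity at infinity, and
   the perturbation delta |z|^2 makes the mean value inequality strict at an interior maximum. *)
lemma subharmonic_le_minus_ln_norm:
  assumes sub: "subharmonic u" and K: "compact K" and F: "F holomorphic_on - K"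
    and F1: "\<And>z. z \<notin> K \<Longrightarrow> norm (F z) \<le> 1"
    and FA: "\<And>z. R0 \<le> norm z \<Longrightarrow> z \<notin> K \<Longrightarrow> norm (F z) \<le> A / norm z"
    and uK: "\<And>z. z \<in> K \<Longrightarrow> u z \<le> ereal (- s)"
    and uC: "\<And>z. R0 \<le> norm z \<Longrightarrow> u z \<le> ereal (ln (norm z) + C)"
    and a: "a \<notin> K" "F a \<noteq> 0"
  shows "u a \<le> ereal (- s - ln (norm (F a)))"
proof -
  have usc: "usc u" and fin: "\<And>z. u z < \<infinity>" using sub by (auto simp: subharmonic_def)
  have lnF: "ln (norm (F z)) \<le> 0" if "z \<notin> K" for z
    using F1[OF that] by (cases "F z = 0") auto
  \<comment> \<open>\<open>R1\<close> does not depend on \<open>\<delta>\<close>, so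
    \<open>\<delta>\<close> can be made small for a fixed \<open>\<epsilon>\<close>.\<close>
  have main: "\<exists>R1. \<forall>\<delta>>0. u a \<le> ereal (- s - (1 + \<epsilon>) * ln (norm (F a)) + \<delta> * R1\<^sup>2)"
    if \<epsilon>: "\<epsilon> > 0" for \<epsilon>
  proof -
    define A' where "A' = max A 1"
    obtain RK where RK: "K \<subseteq> ball 0 RK"
      using bounded_subset_ballD[OF compact_imp_bounded[OF K]] by blast
    \<comment> \<open>The last entry keeps the maximum off the boundary: on |z| = R1 the growth of u
      and the decay of F give u + s + (1 + epsilon) log |F| <= C + s + (1 + epsilon) ln A' - epsilon
      ln R1 <= 0. Since A' >= 1, its logarithm is meaningful whatever the sign of
      \<open>A\<close>.\<close>
    define R1 where "R1 = Max {1, norm a + 1, R0, RK, exp ((C + s + (1 + \<epsilon>) * ln A') / \<epsilon>)}"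
    have "1 \<le> R1" "norm a + 1 \<le> R1" "R0 \<le> R1" "RK \<le> R1" and expR: "exp ((C + s + (1 + \<epsilon>) * ln A') / \<epsilon>) \<le> R1"
      unfolding R1_def by (rule Max_ge; simp)+
    then have R1: "R1 > 0" "norm a < R1" "R0 \<le> R1" "RK \<le> R1" by linarith+
    have "(C + s + (1 + \<epsilon>) * ln A') / \<epsilon> \<le> ln R1"
      using expR R1 by (simp add: ln_ge_iff)
    then have lnR: "C + s + (1 + \<epsilon>) * ln A' \<le> \<epsilon> * ln R1"
      using \<epsilon> by (simp add: pos_divide_le_eq mult.commute)
    have KR: "K \<subseteq> ball 0 R1" using RK R1(4) by auto
    have "u a \<le> ereal (- s - (1 + \<epsilon>) * ln (norm (F a)) + \<delta> * R1\<^sup>2)" if \<delta>: "\<delta> > 0" for \<delta>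
    proof (rule ccontr)
      assume neg: "\<not> ?thesis"
      define q where "q z = - s - (1 + \<epsilon>) * ln (norm (F z)) - \<delta> * (norm z)\<^sup>2" for z
      obtain x1 where x1: "u a = ereal x1" using neg fin[of a] by (cases "u a") auto
      define m where "m = x1 - q a"
      have "0 \<le> \<delta> * (norm a)\<^sup>2" using \<delta> by simp
      then have m: "\<delta> * R1\<^sup>2 < m" using neg unfolding x1 m_def q_def by simp
      obtain zU where zU: "\<And>z. z \<in> cball 0 R1 \<Longrightarrow> u z \<le> u zU"
        using usc_diff_attains_max[OF usc compact_cball, of 0 R1 "\<lambda>_. 0"] R1(1) by (auto simp: zero_ereal_def[symmetric] Ball_def)
      obtain U0 where U0: "\<And>z. z \<in> cball 0 R1 \<Longrightarrow> u z \<le> ereal U0"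
      proof (cases "u zU")
        case (real U)
        then show ?thesis using zU that[of U] by simp
      next
        case PInf
        then show ?thesis using fin[of zU] by simp
      next
        case MInf
        then show ?thesis using zU[of a] R1(2) x1 by simp
      qed
      \<comment> \<open>The maximum of u - q is sought on the ball without \<open>K\<close> and the
        zeros of \<open>F\<close>, which is not compact. At a point with u - q >= m, however, u
        exceeds -s by a fixed amount because log |F| <= 0, and |F| >= \<open>\<tau>\<close> because
        u <= U0. So all candidates lie in the compact set \<open>Z\<close> below, which is disjoint
        from \<open>K\<close>.\<close>
      define P where "P = {z. ereal (m - s - \<delta> * R1\<^sup>2) \<le> u z}"
      have closedP: "closed P"
      proof -
        have "- P = {z. u z < ereal (m - s - \<delta> * R1\<^sup>2)}" by (auto simp: P_def)
        then show ?thesis using usc by (simp add: closed_def usc_def)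
      qed
      have PK: "P \<inter> K = {}"
      proof (safe)
        fix z assume "z \<in> P" "z \<in> K"
        then have "ereal (m - s - \<delta> * R1\<^sup>2) \<le> ereal (- s)" using order_trans[OF _ uK[of z]] unfolding P_def by blast
        then show "z \<in> {}" using m by simp
      qed
      define \<tau> where "\<tau> = exp ((m - U0 - s - \<delta> * R1\<^sup>2) / (1 + \<epsilon>))"
      define Z where "Z = {z \<in> cball 0 R1 \<inter> P. \<tau> \<le> norm (F z)}"
      have contF: "continuous_on (- K) F" using F by (rule holomorphic_on_imp_continuous_on)
      have "closed Z"
        unfolding Z_def using PK closedP
        by (intro continuous_on_closed_Collect_le continuous_intros continuous_on_subset[OF contF]) auto
      then have compZ: "compact Z"
        using bounded_subset[OF bounded_cball, of Z 0 R1] unfolding compact_eq_bounded_closed Z_def by blast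
      have Z_K: "z \<notin> K" "F z \<noteq> 0" "norm z \<le> R1" if "z \<in> Z" for z
        using that PK by (auto simp: Z_def \<tau>_def) 
      have inZ: "z \<in> Z" if A: "z \<in> cball 0 R1" "z \<notin> K" "F z \<noteq> 0" "ereal m \<le> u z - ereal (q z)" for z
      proof -
        obtain x where x: "u z = ereal x" using A(4) fin[of z] by (cases "u z") auto
        have xm: "m + q z \<le> x" using A(4) x by simp
        have xU: "x \<le> U0" using U0[OF A(1)] x by simp
        have nz: "\<delta> * (norm z)\<^sup>2 \<le> \<delta> * R1\<^sup>2" using A(1) \<delta> by (intro mult_left_mono power_mono) auto
        have "0 \<le> - ((1 + \<epsilon>) * ln (norm (F z)))"
          using lnF[OF A(2)] \<epsilon> by (simp add: mult_le_0_iff)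
        then have "m - s - \<delta> * R1\<^sup>2 \<le> x" using xm nz unfolding q_def by linarith
        then have "z \<in> P" using x by (simp add: P_def)
        moreover have "m - U0 - s - \<delta> * R1\<^sup>2 \<le> ln (norm (F z)) * (1 + \<epsilon>)"
          using xm nz xU unfolding q_def by (simp add: algebra_simps)
        then have "(m - U0 - s - \<delta> * R1\<^sup>2) / (1 + \<epsilon>) \<le> ln (norm (F z))"
          using \<epsilon> by (simp add: pos_divide_le_eq)
        then have "\<tau> \<le> norm (F z)" using A(3) by (simp add: \<tau>_def ln_ge_iff)
        ultimately show ?thesis using A(1) by (simp add: Z_def)
      qed
      have aZ: "a \<in> Z" using R1(2) a x1 by (intro inZ) (auto simp: m_def)
      have "continuous_on Z q"
        unfolding q_def using Z_K by (intro continuous_intros continuous_on_subset[OF contF]) auto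
      then obtain z2 where z2: "z2 \<in> Z" "\<And>w. w \<in> Z \<Longrightarrow> u w - ereal (q w) \<le> u z2 - ereal (q z2)"
        using usc_diff_attains_max[OF usc compZ, of q] aZ by auto
      have h2: "ereal m \<le> u z2 - ereal (q z2)" using z2(2)[OF aZ] x1 by (simp add: m_def)
      then obtain x2 where x2: "u z2 = ereal x2" using fin[of z2] by (cases "u z2") auto
      have max: "u w - ereal (q w) \<le> ereal (x2 - q z2)" if "w \<in> cball 0 R1" "w \<notin> K" "F w \<noteq> 0" for w
      proof (cases "w \<in> Z")
        case True
        then show ?thesis using z2(2)[of w] x2 by simp
      next
        case False
        then have "u w - ereal (q w) < ereal m" using inZ[of w] that by (meson not_le)
        also have "\<dots> \<le> ereal (x2 - q z2)" using h2 x2 by simp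
        finally show ?thesis by simp
      qed
      have "norm z2 \<noteq> R1"
      proof
        assume z2R: "norm z2 = R1"
        have "norm (F z2) \<le> A / R1" using FA[of z2] z2R R1(3) Z_K[OF z2(1)] by simp
        also have "\<dots> \<le> A' / R1" using R1(1) by (intro divide_right_mono) (auto simp: A'_def)
        finally have "ln (norm (F z2)) \<le> ln (A' / R1)" using Z_K[OF z2(1)] R1(1)
          by (subst ln_le_cancel_iff) (auto simp: A'_def intro!: divide_pos_pos)
        also have "\<dots> = ln A' - ln R1" using R1(1) by (simp add: ln_div A'_def)
        finally have "(1 + \<epsilon>) * ln (norm (F z2)) \<le> (1 + \<epsilon>) * (ln A' - ln R1)"
          using \<epsilon> by (intro mult_left_mono) auto
        moreover have "x2 \<le> ln R1 + C" using uC[of z2] z2R R1(3) x2 by simp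
        ultimately have "x2 - q z2 \<le> \<delta> * R1\<^sup>2" using lnR z2R by (simp add: q_def algebra_simps)
        then show False using h2 x2 m by simp
      qed
      then have z2R: "norm z2 < R1" using Z_K[OF z2(1)] by simp
      have "open (ball 0 R1 - K)" using compact_imp_closed[OF K] by (intro open_Diff) auto
      moreover have "continuous_on (ball 0 R1 - K) F" by (rule continuous_on_subset[OF contF]) auto
      ultimately have "open ((ball 0 R1 - K) \<inter> F -` (- {0}))"
        by (intro continuous_open_preimage) auto
      moreover have "z2 \<in> (ball 0 R1 - K) \<inter> F -` (- {0})" using z2R Z_K[OF z2(1)] by auto
      ultimately obtain r0 where r0: "r0 > 0" "ball z2 r0 \<subseteq> (ball 0 R1 - K) \<inter> F -` (- {0})"
        using open_contains_ball by blast
      have "F holomorphic_on ball z2 r0" using r0(2) by (intro holomorphic_on_subset[OF F]) auto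
      moreover have "F x \<noteq> 0" if "x \<in> ball z2 r0" for x using r0(2) that by auto
      moreover have "z2 \<in> ball z2 r0" using r0(1) by simp
      ultimately obtain g where g: "g holomorphic_on ball z2 r0" "\<And>x. x \<in> ball z2 r0 \<Longrightarrow> exp (g x) = F x"
        by (rule holomorphic_logarithm_exists[OF convex_ball open_ball]) blast+
      have Reg: "ln (norm (F w)) = Re (g w)" if "w \<in> ball z2 r0" for w
        using g(2)[OF that, symmetric] by simp
      define r where "r = r0 / 2"
      have r: "r > 0" "cball z2 r \<subseteq> ball z2 r0" using r0(1) by (auto simp: r_def)
      \<comment> \<open>On the circle |w - z2| = r the function |w|^2 agrees with a harmonic
        function whose value at the centre exceeds |z2|^2 by r^2. So Re G majorises u on the circle
        by maximality of z2, but at z2 it falls short of u by delta r^2.\<close>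
      define G where "G w = of_real (x2 - q z2 - s - \<delta> * ((norm z2)\<^sup>2 + r\<^sup>2))
          - of_real (1 + \<epsilon>) * g w - of_real (2 * \<delta>) * cnj z2 * (w - z2)" for w
      have "u z2 \<le> ereal (Re (G z2))"
      proof (rule subharmonic_le_Re_holomorphic[OF sub r(1)])
        show "G holomorphic_on cball z2 r"
          unfolding G_def by (intro holomorphic_intros holomorphic_on_subset[OF g(1) r(2)])
        fix w assume w: "w \<in> sphere z2 r"
        then have wb: "w \<in> ball z2 r0" using r by auto
        have "(norm w)\<^sup>2 = (norm (z2 + (w - z2)))\<^sup>2" by simp
        also have "\<dots> = (norm z2)\<^sup>2 + (norm (w - z2))\<^sup>2 + 2 * Re (cnj z2 * (w - z2))"
          by (simp only: cmod_power2 plus_complex.simps) (simp add: power2_eq_square algebra_simps)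
        also have "norm (w - z2) = r" using w by (simp add: dist_norm norm_minus_commute)
        finally have nw: "(norm w)\<^sup>2 = (norm z2)\<^sup>2 + r\<^sup>2 + 2 * Re (cnj z2 * (w - z2))" .
        have "Re (G w) = x2 - q z2 + q w"
          unfolding q_def[of w] Reg[OF wb] nw by (simp add: G_def algebra_simps)
        moreover have "u w - ereal (q w) \<le> ereal (x2 - q z2)"
          using wb r0(2) by (intro max) auto
        ultimately show "u w \<le> ereal (Re (G w))" by (cases "u w") auto
      qed
      moreover have "Re (G z2) = x2 - \<delta> * r\<^sup>2"
        using r0(1) Reg[of z2] by (simp add: G_def q_def algebra_simps)
      moreover have "\<delta> * r\<^sup>2 > 0" using \<delta> r(1) by simp
      ultimately show False using x2 by simp
    qed
    then show ?thesis by blast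
  qed
  show ?thesis
  proof (cases "u a")
    case (real x)
    define L where "L = ln (norm (F a))"
    have "x \<le> - s - L + e" if e: "e > 0" for e
    proof -
      \<comment> \<open>With this choice |epsilon L| <= e/2; the other half of e is left for delta
        R1^2. The summand 1 in the denominator covers L = 0.\<close>
      define \<epsilon> where "\<epsilon> = e / (2 * (1 + \<bar>L\<bar>))"
      have \<epsilon>: "\<epsilon> > 0" using e by (simp add: \<epsilon>_def divide_pos_pos)
      obtain R1 where R1: "\<And>\<delta>. \<delta> > 0 \<Longrightarrow> x \<le> - s - (1 + \<epsilon>) * L + \<delta> * R1\<^sup>2"
        using main[OF \<epsilon>] real by (auto simp: L_def)
      have "x \<le> - s - (1 + \<epsilon>) * L + e / (2 * (1 + R1\<^sup>2)) * R1\<^sup>2"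
        using e by (intro R1 divide_pos_pos mult_pos_pos add_pos_nonneg) auto
      moreover have "e / (2 * (1 + R1\<^sup>2)) * R1\<^sup>2 \<le> e / 2"
      proof -
        have "0 < 1 + R1\<^sup>2" by (simp add: add_pos_nonneg)
        then show ?thesis using e by (simp add: field_simps)
      qed
      moreover have "\<bar>\<epsilon> * L\<bar> \<le> e / 2"
      proof -
        have "\<bar>\<epsilon> * L\<bar> = e / 2 * (\<bar>L\<bar> / (1 + \<bar>L\<bar>))" using e by (simp add: \<epsilon>_def abs_mult)
        also have "\<dots> \<le> e / 2 * 1" using e by (intro mult_left_mono) (auto simp: field_simps)
        finally show ?thesis by simp
      qed
      moreover have "(1 + \<epsilon>) * L = L + \<epsilon> * L" by (simp add: distrib_right)
      ultimately show ?thesis by linarith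
    qed
    then have "x \<le> - s - L" by (rule field_le_epsilon)
    then show ?thesis using real by (simp add: L_def)
  qed (use fin[of a] in auto)
qed

subsection \<open>Invariance of Lebesgue measure and integrals over discs\<close>

lemma translation_invariant_emeasure:
  fixes M :: "'a::euclidean_space measure"
  assumes sets: "sets M = sets borel" and "sigma_finite_measure M"
    and inv: "\<And>c. distr M borel ((+) c) = M" and A: "A \<in> sets borel"
  shows "emeasure M A * emeasure lborel (ball (0::'a) 1) = emeasure lborel A * emeasure M (ball 0 1)"
proof -
  interpret M: sigma_finite_measure M by fact
  interpret P: pair_sigma_finite M "lborel :: 'a measure" ..
  define B where "B = ball (0::'a) 1"
  note [measurable] = A
  have [measurable]: "B \<in> sets borel" by (simp add: B_def)
  have [measurable_cong]: "sets M = sets borel" by (fact sets)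
  have shift: "(\<integral>\<^sup>+x. f (c + x) \<partial>M) = (\<integral>\<^sup>+x. f x \<partial>M)" if "f \<in> borel_measurable borel" for f :: "'a \<Rightarrow> ennreal" and c
  proof -
    have "(\<integral>\<^sup>+x. f x \<partial>distr M borel ((+) c)) = (\<integral>\<^sup>+x. f (c + x) \<partial>M)"
      by (rule nn_integral_distr) (use that in measurable)
    then show ?thesis by (simp add: inv)
  qed
  have "emeasure M A * emeasure lborel B = (\<integral>\<^sup>+y. (\<integral>\<^sup>+x. indicator A x * indicator B y \<partial>M) \<partial>lborel)"
    by (simp add: nn_integral_multc nn_integral_cmult sets)
  also have "\<dots> = (\<integral>\<^sup>+y. (\<integral>\<^sup>+x. indicator A (y + x) * indicator B y \<partial>M) \<partial>lborel)"
  proof (rule nn_integral_cong)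
    fix y
    show "(\<integral>\<^sup>+x. indicator A x * indicator B y \<partial>M) = (\<integral>\<^sup>+x. indicator A (y + x) * indicator B y \<partial>M)"
      using shift[of "\<lambda>x. indicator A x * indicator B y" y] by simp
  qed
  also have "\<dots> = (\<integral>\<^sup>+x. (\<integral>\<^sup>+y. indicator A (y + x) * indicator B y \<partial>lborel) \<partial>M)"
    by (rule P.Fubini') measurable
  also have "\<dots> = (\<integral>\<^sup>+x. (\<integral>\<^sup>+y. indicator A y * indicator B (y - x) \<partial>lborel) \<partial>M)"
  proof (rule nn_integral_cong)
    fix x :: 'a
    have "(\<integral>\<^sup>+y. indicator A y * indicator B (y - x) \<partial>distr lborel borel ((+) x))
        = (\<integral>\<^sup>+y. indicator A (x + y) * indicator B (x + y - x) \<partial>lborel)"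
      by (rule nn_integral_distr) measurable
    then show "(\<integral>\<^sup>+y. indicator A (y + x) * indicator B y \<partial>lborel) = (\<integral>\<^sup>+y. indicator A y * indicator B (y - x) \<partial>lborel)"
      by (simp add: lborel_distr_plus add.commute)
  qed
  also have "\<dots> = (\<integral>\<^sup>+y. (\<integral>\<^sup>+x. indicator A y * indicator B (y - x) \<partial>M) \<partial>lborel)"
    by (rule P.Fubini'[symmetric]) measurable
  also have "\<dots> = (\<integral>\<^sup>+y. (\<integral>\<^sup>+x. indicator A y * indicator B x \<partial>M) \<partial>lborel)"
  proof (rule nn_integral_cong)
    fix y
    have sym: "indicator B (y - x) = (indicator B (- y + x) :: ennreal)" for x
      by (auto simp: B_def indicator_def dist_norm norm_minus_commute)
    show "(\<integral>\<^sup>+x. indicator A y * indicator B (y - x) \<partial>M) = (\<integral>\<^sup>+x. indicator A y * indicator B x \<partial>M)"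
      unfolding sym using shift[of "\<lambda>x. indicator A y * indicator B x" "- y"] by simp
  qed
  also have "\<dots> = emeasure lborel A * emeasure M B"
    by (simp add: nn_integral_multc nn_integral_cmult sets)
  finally show ?thesis by (simp add: B_def)
qed

text \<open>The image measure is again translation invariant, because \<open>f\<close> is onto, and
  it gives each ball about 0 its Lebesgue measure; so the factor in the uniqueness of Haar measure
  is 1.\<close>

lemma distr_lborel_linear_isometry:
  fixes f :: "'a::euclidean_space \<Rightarrow> 'a"
  assumes f: "linear f" and iso: "\<And>x. norm (f x) = norm x"
  shows "distr lborel borel f = lborel"
proof -
  have "continuous_on UNIV f" using f by (simp add: linear_continuous_on linear_linear)
  then have f_meas [measurable]: "f \<in> borel_measurable borel" by (rule borel_measurable_continuous_onI)
  have "inj f" using f iso by (auto simp: linear_injective_0) (metis norm_eq_zero)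
  with f have surj: "surj f" by (rule linear_injective_imp_surjective) (rule refl)
  define M where "M = distr lborel borel f"
  have em: "emeasure M A = emeasure lborel (f -` A)" if "A \<in> sets borel" for A
    using that unfolding M_def by (subst emeasure_distr) auto
  have ball: "emeasure M (ball 0 r) = emeasure lborel (ball (0::'a) r)" for r
    by (subst em) (auto simp: vimage_def iso ball_def)
  have "sigma_finite_measure M"
  proof
    show "\<exists>A. countable A \<and> A \<subseteq> sets M \<and> \<Union> A = space M \<and> (\<forall>a\<in>A. emeasure M a \<noteq> \<infinity>)"
    proof (intro exI conjI ballI)
      show "countable (range (\<lambda>n. ball (0::'a) (real n)))" by simp
      show "\<Union> (range (\<lambda>n. ball (0::'a) (real n))) = space M"
        by (auto simp: M_def intro: reals_Archimedean2)
      show "emeasure M a \<noteq> \<infinity>" if a: "a \<in> range (\<lambda>n. ball (0::'a) (real n))" for a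
      proof -
        obtain n where "a = ball (0::'a) (real n)" using a by blast
        then show ?thesis using emeasure_lborel_ball_finite[of "0::'a" "real n"] by (simp add: ball)
      qed
    qed (auto simp: M_def)
  qed
  moreover have "distr M borel ((+) c) = M" for c
  proof -
    obtain c' where c': "c = f c'" using surj by blast
    have "distr M borel ((+) c) = distr lborel borel (\<lambda>x. f (c' + x))"
      unfolding M_def c' by (subst distr_distr) (auto simp: o_def linear_add[OF f])
    also have "\<dots> = distr (distr lborel borel ((+) c')) borel f"
      by (subst distr_distr) (auto simp: o_def)
    finally show ?thesis by (simp add: lborel_distr_plus M_def)
  qed
  ultimately have eq: "emeasure M A * emeasure lborel (ball (0::'a) 1) = emeasure lborel A * emeasure M (ball 0 1)"
    if "A \<in> sets borel" for A
    using that by (intro translation_invariant_emeasure) (auto simp: M_def)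
  have b: "emeasure lborel (ball (0::'a) 1) \<noteq> 0" "emeasure lborel (ball (0::'a) 1) \<noteq> \<infinity>"
    using emeasure_lborel_ball_finite[of "0::'a" 1] by (auto simp: emeasure_ball unit_ball_vol_pos less_imp_neq[symmetric])
  show ?thesis
    unfolding M_def[symmetric]
  proof (rule measure_eqI)
    fix A assume "A \<in> sets M"
    then have "A \<in> sets borel" by (simp add: M_def)
    from eq[OF this, unfolded ball] b show "emeasure M A = emeasure lborel A"
      by (simp add: ennreal_mult_cancel_left mult.commute[of _ "emeasure lborel (ball (0::'a) 1)"])
  qed (simp add: M_def)
qed

text \<open>The Jacobian is read off from norms, since \<open>f\<close> is c times a linear
  isometry. The main use is multiplication by a complex number, in the plane and on C^n.\<close>

lemma nn_integral_lborel_similarity: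
  fixes f :: "'a::euclidean_space \<Rightarrow> 'a"
  assumes f: "linear f" and c: "c > 0" and norm: "\<And>x. norm (f x) = c * norm x"
    and g[measurable]: "g \<in> borel_measurable borel"
  shows "ennreal (c ^ DIM('a)) * (\<integral>\<^sup>+x. g (f x) \<partial>lborel) = (\<integral>\<^sup>+x. g x \<partial>lborel)"
proof -
  define h where "h x = (1 / c) *\<^sub>R f x" for x
  have h: "linear h" unfolding h_def using f by (intro linear_compose_scale_right)
  then have "continuous_on UNIV h" by (simp add: linear_continuous_on linear_linear)
  then have [measurable]: "h \<in> borel_measurable borel" by (rule borel_measurable_continuous_onI)
  have h_iso: "norm (h x) = norm x" for x using c by (simp add: h_def norm)
  have fh: "f x = c *\<^sub>R h x" for x using c by (simp add: h_def)
  have "(\<integral>\<^sup>+x. g x \<partial>lborel) = (\<integral>\<^sup>+x. g x \<partial>density (distr lborel borel (\<lambda>x. 0 + c *\<^sub>R x)) (\<lambda>_. \<bar>c\<bar>^DIM('a)))"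
    using lborel_affine[of c "0::'a"] c by simp
  also have "\<dots> = ennreal (c ^ DIM('a)) * (\<integral>\<^sup>+x. g (c *\<^sub>R x) \<partial>lborel)"
    using c by (simp add: nn_integral_density nn_integral_cmult nn_integral_distr ennreal_power)
  also have "(\<integral>\<^sup>+x. g (c *\<^sub>R x) \<partial>lborel) = (\<integral>\<^sup>+x. g (c *\<^sub>R x) \<partial>distr lborel borel h)"
    by (simp add: distr_lborel_linear_isometry[OF h h_iso])
  also have "\<dots> = (\<integral>\<^sup>+x. g (f x) \<partial>lborel)"
    by (subst nn_integral_distr) (auto simp: fh)
  finally show ?thesis by simp
qed

section \<open>Planar integrals in slope coordinates\<close>

lemma nn_integral_complex:
  assumes g[measurable]: "g \<in> borel_measurable borel"
  shows "(\<integral>\<^sup>+z. g z \<partial>lborel) = (\<integral>\<^sup>+x. \<integral>\<^sup>+y. g (Complex x y) \<partial>lborel \<partial>lborel)"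
proof -
  define c where "c = (\<lambda>(x, y). Complex x y)"
  have c_meas [measurable]: "c \<in> borel_measurable borel"
    unfolding c_def case_prod_beta Complex_eq
    by (intro borel_measurable_continuous_onI continuous_intros)
  have c_meas' [measurable]: "c \<in> borel_measurable (lborel \<Otimes>\<^sub>M lborel)"
    using c_meas by (simp add: lborel_prod)
  have eq: "lborel = distr (lborel \<Otimes>\<^sub>M lborel) borel c"
  proof (rule lborel_eqI)
    fix l u :: complex assume le: "\<And>b. b \<in> Basis \<Longrightarrow> l \<bullet> b \<le> u \<bullet> b"
    have "c -` box l u = {Re l<..<Re u} \<times> {Im l<..<Im u}"
      by (auto simp: c_def box_def Basis_complex_def)
    then show "emeasure (distr (lborel \<Otimes>\<^sub>M lborel) borel c) (box l u) = (\<Prod>b\<in>Basis. (u - l) \<bullet> b)"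
      using le[of 1] le[of \<i>]
      by (simp add: emeasure_distr space_pair_measure lborel.emeasure_pair_measure_Times Basis_complex_def ennreal_mult)
  qed simp
  have "(\<integral>\<^sup>+z. g z \<partial>lborel) = (\<integral>\<^sup>+z. g z \<partial>distr (lborel \<Otimes>\<^sub>M lborel) borel c)"
    by (rule arg_cong[OF eq])
  also have "\<dots> = (\<integral>\<^sup>+p. g (c p) \<partial>(lborel \<Otimes>\<^sub>M lborel))"
    by (rule nn_integral_distr) measurable
  also have "\<dots> = (\<integral>\<^sup>+x. \<integral>\<^sup>+y. g (c (x, y)) \<partial>lborel \<partial>lborel)"
    by (rule lborel.nn_integral_fst[symmetric]) measurable
  finally show ?thesis by (simp add: c_def)
qed

text \<open>Polar coordinates with the slope t = y / x in place of the angle. The Jacobian is x, the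
  integrands met below become rational, and the disc of radius a about a > 0 becomes 0 < x < 2 a /
  (1 + t^2).\<close>

lemma nn_integral_complex_slopes:
  assumes g[measurable]: "g \<in> borel_measurable borel" and g0: "\<And>z. Re z \<le> 0 \<Longrightarrow> g z = 0"
  shows "(\<integral>\<^sup>+z. g z \<partial>lborel) = (\<integral>\<^sup>+t. (\<integral>\<^sup>+x\<in>{0<..}. g (Complex x (x * t)) * ennreal x \<partial>lborel) \<partial>lborel)"
proof -
  have [measurable]: "(\<lambda>p. Complex (f p) (h p)) \<in> borel_measurable M"
    if [measurable]: "f \<in> borel_measurable M" "h \<in> borel_measurable M" for M :: "'b measure" and f h
    by (simp add: Complex_eq)
  have "(\<integral>\<^sup>+z. g z \<partial>lborel) = (\<integral>\<^sup>+x. \<integral>\<^sup>+t. g (Complex x (x * t)) * ennreal x * indicator {0<..} x \<partial>lborel \<partial>lborel)"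
    unfolding nn_integral_complex[OF g]
  proof (rule nn_integral_cong)
    fix x :: real
    show "(\<integral>\<^sup>+y. g (Complex x y) \<partial>lborel) = (\<integral>\<^sup>+t. g (Complex x (x * t)) * ennreal x * indicator {0<..} x \<partial>lborel)"
    proof (cases "x > 0")
      case True
      then have "(\<integral>\<^sup>+y. g (Complex x y) \<partial>lborel) = x * (\<integral>\<^sup>+t. g (Complex x (0 + x * t)) \<partial>lborel)"
        by (subst nn_integral_real_affine[of _ x 0]) auto
      then show ?thesis using True by (simp add: nn_integral_cmult mult.commute)
    qed (simp add: g0)
  qed
  also have "\<dots> = (\<integral>\<^sup>+t. \<integral>\<^sup>+x. g (Complex x (x * t)) * ennreal x * indicator {0<..} x \<partial>lborel \<partial>lborel)"
    by (rule lborel_pair.Fubini') measurable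
  finally show ?thesis .
qed

text \<open>Wallis-type integrals by the recursion that integration by parts gives: (2n + 2) A_(n+1)
  = t / (1 + t^2)^(n+1) + (2n + 1) A_n. The first term on the right vanishes at 0 and at infinity,
  so only the factor (2n + 1) / (2n + 2) acts on the limit.\<close>

lemma arctan_type_antiderivative:
  "\<exists>A::real \<Rightarrow> real. A 0 = 0 \<and> (\<forall>t. (A has_real_derivative 1 / (1 + t\<^sup>2) ^ (n + 1)) (at t))
     \<and> (A \<longlongrightarrow> pi / 2 * (fact (2 * n) / (4 ^ n * (fact n)\<^sup>2))) at_top"
proof (induction n)
  case 0
  show ?case
    by (intro exI[of _ arctan] conjI allI) (auto intro!: derivative_eq_intros tendsto_arctan_at_top simp: field_simps)
next
  case (Suc n)
  then obtain A where A: "A 0 = 0" "\<And>t. (A has_real_derivative 1 / (1 + t\<^sup>2) ^ (n + 1)) (at t)"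
    "(A \<longlongrightarrow> pi / 2 * (fact (2 * n) / (4 ^ n * (fact n)\<^sup>2))) at_top" by blast
  define B where "B t = (t / (1 + t\<^sup>2) ^ (n + 1) + (2 * n + 1) * A t) / (2 * n + 2)" for t
  have pos: "1 + t\<^sup>2 > 0" for t :: real by (simp add: add_pos_nonneg)
  have "(B has_real_derivative 1 / (1 + t\<^sup>2) ^ (Suc n + 1)) (at t)" for t
  proof -
    define w where "w = 1 + t\<^sup>2"
    have w: "w > 0" "t\<^sup>2 = w - 1" using pos[of t] by (auto simp: w_def)
    have "((\<lambda>t. 1 + t\<^sup>2) has_real_derivative 2 * t) (at t)"
      by (auto intro!: derivative_eq_intros)
    from DERIV_power[OF this, of "n + 1"]
    have d: "((\<lambda>t. (1 + t\<^sup>2) ^ (n + 1)) has_real_derivative of_nat (n + 1) * (2 * t) * (1 + t\<^sup>2) ^ n) (at t)"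
      by (simp add: algebra_simps)
    have "(B has_real_derivative
        ((1 * w ^ (n + 1) - t * (of_nat (n + 1) * (2 * t) * w ^ n)) / (w ^ (n + 1) * w ^ (n + 1))
          + (2 * n + 1) * (1 / w ^ (n + 1))) / (2 * n + 2)) (at t)"
      unfolding B_def w_def using pos[of t]
      by (intro DERIV_cdivide DERIV_add DERIV_divide DERIV_ident d DERIV_cmult A(2)) simp
    moreover have "((1 * w ^ (n + 1) - t * (of_nat (n + 1) * (2 * t) * w ^ n)) / (w ^ (n + 1) * w ^ (n + 1))
          + (2 * n + 1) * (1 / w ^ (n + 1))) / (2 * n + 2) = 1 / w ^ (Suc n + 1)"
    proof -
      have tt: "t * t = w - 1" using w(2) by (simp add: power2_eq_square)
      \<comment> \<open>\<open>W\<close> stands for w^n and \<open>N\<close> for n + 1; with t^2 = w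
        - 1 inserted the identity is rational in w, W and N.\<close>
      have alg: "((1 * (w * W) - t * (N * (2 * t) * W)) / ((w * W) * (w * W)) + (2 * N - 1) * (1 / (w * W))) / (2 * N)
          = 1 / (w * (w * W))" if "W > 0" "N > 0" for W N :: real
      proof -
        have "t * (N * (2 * t) * W) = 2 * N * (w - 1) * W" unfolding tt[symmetric] by simp
        then have "1 * (w * W) - t * (N * (2 * t) * W) = W * (2 * N - (2 * N - 1) * w)"
          by (simp only:) (simp add: algebra_simps)
        then have "(1 * (w * W) - t * (N * (2 * t) * W)) / ((w * W) * (w * W)) = (2 * N - (2 * N - 1) * w) / (w * w * W)"
          using that by simp
        moreover have "(2 * N - 1) * (1 / (w * W)) = ((2 * N - 1) * w) / (w * w * W)" using w(1) by simp
        ultimately show ?thesis using that w(1)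
          by (simp only: add_divide_distrib[symmetric]) simp
      qed
      from alg[of "w ^ n" "real (n + 1)"] show ?thesis using w(1) by (simp add: algebra_simps)
    qed
    ultimately show ?thesis unfolding w_def[symmetric] by simp
  qed
  moreover have "(B \<longlongrightarrow> pi / 2 * (fact (2 * Suc n) / (4 ^ Suc n * (fact (Suc n))\<^sup>2))) at_top"
  proof -
    have "((\<lambda>t::real. t / (1 + t\<^sup>2) ^ (n + 1)) \<longlongrightarrow> 0) at_top"
    proof (rule Lim_null_comparison)
      show "\<forall>\<^sub>F t in at_top. norm (t / (1 + t\<^sup>2) ^ (n + 1)) \<le> inverse (t::real)"
        using eventually_gt_at_top[of 0]
      proof eventually_elim
        case (elim t)
        have "t\<^sup>2 \<le> (1 + t\<^sup>2) ^ 1" by simp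
        also have "\<dots> \<le> (1 + t\<^sup>2) ^ (n + 1)" by (rule power_increasing) auto
        finally have "t\<^sup>2 \<le> (1 + t\<^sup>2) ^ (n + 1)" .
        moreover have "t / p \<le> inverse t" if "t\<^sup>2 \<le> p" "p > 0" for p
          using that elim by (simp add: field_simps power2_eq_square)
        ultimately have "t / (1 + t\<^sup>2) ^ (n + 1) \<le> inverse t" using pos[of t] by simp
        then show ?case using elim pos[of t] by simp
      qed
      show "(inverse \<longlongrightarrow> (0::real)) at_top" by (rule tendsto_inverse_0_at_top) (rule filterlim_ident)
    qed
    then have "(B \<longlongrightarrow> (0 + (2 * n + 1) * (pi / 2 * (fact (2 * n) / (4 ^ n * (fact n)\<^sup>2)))) / (2 * n + 2)) at_top"
      unfolding B_def by (intro tendsto_intros A(3)) auto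
    also have "(0 + (2 * n + 1) * (pi / 2 * (fact (2 * n) / (4 ^ n * (fact n)\<^sup>2)))) / (2 * n + 2)
        = pi / 2 * (fact (2 * Suc n) / (4 ^ Suc n * (fact (Suc n))\<^sup>2))"
    proof -
      have "fact (2 * Suc n) = (2 * real (n + 1)) * (2 * real (n + 1) - 1) * fact (2 * n)"
        by (simp add: algebra_simps)
      moreover have "fact (Suc n) = real (n + 1) * fact n" by simp
      moreover have "(0 + (2 * m - 1) * (pi / 2 * (f / (p * g\<^sup>2)))) / (2 * m)
          = pi / 2 * ((2 * m) * (2 * m - 1) * f / (4 * p * (m * g)\<^sup>2))" if "m > 0" for m f p g :: real
        using that by (cases "p = 0 \<or> g = 0") (auto simp: field_simps power2_eq_square)
      from this[of "real (n + 1)" "fact (2 * n)" "4 ^ n" "fact n"]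
      have "(0 + (2 * n + 1) * (pi / 2 * (fact (2 * n) / (4 ^ n * (fact n)\<^sup>2)))) / (2 * n + 2)
          = pi / 2 * ((2 * real (n + 1)) * (2 * real (n + 1) - 1) * fact (2 * n) / (4 ^ Suc n * (real (n + 1) * fact n)\<^sup>2))"
        by (simp add: add.commute)
      ultimately show ?thesis by (simp only:)
    qed
    finally show ?thesis .
  qed
  moreover have "B 0 = 0" by (simp add: B_def A(1))
  ultimately show ?case by blast
qed

lemma nn_integral_inverse_one_plus_square_power:
  "(\<integral>\<^sup>+t. ennreal (1 / (1 + t\<^sup>2) ^ (n + 1)) \<partial>lborel) = ennreal (pi * fact (2 * n) / (4 ^ n * (fact n)\<^sup>2))"
proof -
  obtain A where A: "A 0 = 0" "\<And>t::real. (A has_real_derivative 1 / (1 + t\<^sup>2) ^ (n + 1)) (at t)"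
    "(A \<longlongrightarrow> pi / 2 * (fact (2 * n) / (4 ^ n * (fact n)\<^sup>2))) at_top"
    using arctan_type_antiderivative[of n] by blast
  define f where "f t = 1 / (1 + t\<^sup>2) ^ (n + 1)" for t :: real
  define c :: real where "c = pi / 2 * (fact (2 * n) / (4 ^ n * (fact n)\<^sup>2))"
  have [measurable]: "f \<in> borel_measurable borel" unfolding f_def by measurable
  have half: "(\<integral>\<^sup>+t. ennreal (f t) * indicator {0..} t \<partial>lborel) = ennreal c"
    using nn_integral_FTC_atLeast[of f 0 A c] A by (auto simp: f_def c_def)
  have "(\<integral>\<^sup>+t. ennreal (f t) * indicator {..<0} t \<partial>lborel) = (\<integral>\<^sup>+t. ennreal (f t) * indicator {0<..} t \<partial>lborel)"
    by (subst nn_integral_real_affine[of _ "-1" 0]) (auto simp: f_def intro!: nn_integral_cong split: split_indicator)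
  also have "\<dots> = (\<integral>\<^sup>+t. ennreal (f t) * indicator {0..} t \<partial>lborel)"
    using AE_lborel_singleton[of "0::real"] by (intro nn_integral_cong_AE) (auto elim!: eventually_mono split: split_indicator)
  finally have "(\<integral>\<^sup>+t. ennreal (f t) * indicator {..<0} t \<partial>lborel) = ennreal c" using half by simp
  moreover have "(\<integral>\<^sup>+t. ennreal (f t) \<partial>lborel)
      = (\<integral>\<^sup>+t. ennreal (f t) * indicator {0..} t + ennreal (f t) * indicator {..<0} t \<partial>lborel)"
    by (intro nn_integral_cong) (auto split: split_indicator)
  ultimately have "(\<integral>\<^sup>+t. ennreal (f t) \<partial>lborel) = ennreal c + ennreal c"
    using half by (simp add: nn_integral_add)
  also have "\<dots> = ennreal (pi * fact (2 * n) / (4 ^ n * (fact n)\<^sup>2))"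
    by (simp add: c_def ennreal_plus[symmetric] del: ennreal_plus)
  finally show ?thesis by (simp add: f_def)
qed

lemma nn_integral_has_integral_Ioo:
  assumes X: "0 \<le> (X::real)" and F: "\<And>x. 0 \<le> x \<Longrightarrow> x \<le> X \<Longrightarrow> (F has_real_derivative f x) (at x)"
    and nonneg: "\<And>x. 0 < x \<Longrightarrow> x < X \<Longrightarrow> 0 \<le> f x"
  shows "(\<integral>\<^sup>+x. ennreal (f x) * indicator {0<..<X} x \<partial>lborel) = ennreal (F X - F 0)"
proof (rule nn_integral_has_integral_lebesgue')
  have "(f has_integral F X - F 0) {0..X}"
  proof (rule fundamental_theorem_of_calculus[OF X])
    fix x assume "x \<in> {0..X}"
    then have "(F has_real_derivative f x) (at x)" by (intro F) auto
    then show "(F has_vector_derivative f x) (at x within {0..X})"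
      unfolding has_real_derivative_iff_has_vector_derivative[symmetric]
      by (rule has_field_derivative_at_within)
  qed
  then show "(f has_integral F X - F 0) {0<..<X}" by (simp add: has_integral_Icc_iff_Ioo)
qed (use nonneg in auto)

text \<open>In slope coordinates |z|^2 = x^2 (1 + t^2) and the disc is 0 < x < 2 / (1 + t^2), so the
  inner integral is that of a monomial and the outer one is the integral of (1 +
  t^2)^(-(n+2)).\<close>

lemma nn_integral_norm_power_ball:
  "(\<integral>\<^sup>+z\<in>ball (1::complex) 1. ennreal (norm z ^ (2 * n)) \<partial>lborel)
     = ennreal (pi * fact (2 * n + 1) / (fact (n + 1))\<^sup>2)"
proof -
  have pos: "1 + t\<^sup>2 > 0" for t :: real by (simp add: add_pos_nonneg)
  have [measurable]: "ball (1::complex) 1 \<in> sets borel" by simp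
  have inball: "z \<in> ball (1::complex) 1 \<longleftrightarrow> (norm z)\<^sup>2 < 2 * Re z" for z
  proof -
    have "z \<in> ball (1::complex) 1 \<longleftrightarrow> (norm (z - 1))\<^sup>2 < 1\<^sup>2"
      by (simp add: dist_norm norm_minus_commute abs_square_less_1)
    also have "\<dots> \<longleftrightarrow> (norm z)\<^sup>2 < 2 * Re z"
      unfolding cmod_power2 by (simp add: power2_eq_square algebra_simps)
    finally show ?thesis .
  qed
  have nC: "(norm (Complex x (x * t)))\<^sup>2 = x\<^sup>2 * (1 + t\<^sup>2)" for x t
    by (simp add: cmod_power2 power_mult_distrib algebra_simps)
  have "(\<integral>\<^sup>+z\<in>ball (1::complex) 1. ennreal (norm z ^ (2 * n)) \<partial>lborel)
      = (\<integral>\<^sup>+t. (\<integral>\<^sup>+x\<in>{0<..}. (ennreal (norm (Complex x (x * t)) ^ (2 * n)) * indicator (ball 1 1) (Complex x (x * t))) * ennreal x \<partial>lborel) \<partial>lborel)"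
  proof (rule nn_integral_complex_slopes)
    show "ennreal (norm z ^ (2 * n)) * indicator (ball 1 1) z = 0" if "Re z \<le> 0" for z :: complex
      using that inball[of z] zero_le_power2[of "norm z"] by (simp add: indicator_def)
  qed measurable
  also have "\<dots> = (\<integral>\<^sup>+t. ennreal (4 ^ (n + 1) / (2 * n + 2)) * ennreal (1 / (1 + t\<^sup>2) ^ (n + 1 + 1)) \<partial>lborel)"
  proof (rule nn_integral_cong)
    fix t :: real
    define X where "X = 2 / (1 + t\<^sup>2)"
    have X: "X > 0" using pos[of t] by (simp add: X_def)
    have "(\<integral>\<^sup>+x\<in>{0<..}. (ennreal (norm (Complex x (x * t)) ^ (2 * n)) * indicator (ball 1 1) (Complex x (x * t))) * ennreal x \<partial>lborel)
        = (\<integral>\<^sup>+x. ennreal ((1 + t\<^sup>2) ^ n * x ^ (2 * n + 1)) * indicator {0<..<X} x \<partial>lborel)"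
    proof (rule nn_integral_cong)
      fix x :: real
      show "ennreal (norm (Complex x (x * t)) ^ (2 * n)) * indicator (ball 1 1) (Complex x (x * t)) * ennreal x * indicator {0<..} x
          = ennreal ((1 + t\<^sup>2) ^ n * x ^ (2 * n + 1)) * indicator {0<..<X} x"
      proof (cases "x > 0")
        case True
        have "Complex x (x * t) \<in> ball 1 1 \<longleftrightarrow> x * (x * (1 + t\<^sup>2)) < x * 2"
          unfolding inball nC by (simp add: power2_eq_square mult_ac)
        also have "\<dots> \<longleftrightarrow> x < X"
          using True pos[of t] by (simp add: X_def pos_less_divide_eq)
        finally have iff: "Complex x (x * t) \<in> ball 1 1 \<longleftrightarrow> x < X" .
        have "norm (Complex x (x * t)) ^ (2 * n) = (1 + t\<^sup>2) ^ n * x ^ (2 * n)"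
          unfolding power_mult nC by (simp add: power_mult_distrib power_mult[symmetric] mult.commute)
        then show ?thesis using True iff pos[of t]
          by (auto simp: indicator_def ennreal_mult'[symmetric] mult.commute mult.left_commute)
      qed simp
    qed
    also have "\<dots> = ennreal ((1 + t\<^sup>2) ^ n * X ^ (2 * n + 2) / (2 * n + 2) - (1 + t\<^sup>2) ^ n * 0 ^ (2 * n + 2) / (2 * n + 2))"
    proof (rule nn_integral_has_integral_Ioo)
      fix x :: real
      show "((\<lambda>x. (1 + t\<^sup>2) ^ n * x ^ (2 * n + 2) / (2 * n + 2)) has_real_derivative (1 + t\<^sup>2) ^ n * x ^ (2 * n + 1)) (at x)"
        by (rule DERIV_cong[OF DERIV_cdivide[OF DERIV_cmult[OF DERIV_pow[of "2 * n + 2" x]]]]) simp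
    qed (use X pos[of t] in auto)
    also have "(1 + t\<^sup>2) ^ n * X ^ (2 * n + 2) / (2 * n + 2) - (1 + t\<^sup>2) ^ n * 0 ^ (2 * n + 2) / (2 * n + 2)
        = 4 ^ (n + 1) / (2 * n + 2) * (1 / (1 + t\<^sup>2) ^ (n + 1 + 1))"
    proof -
      define w where "w = 1 + t\<^sup>2"
      have w: "w > 0" using pos[of t] by (simp add: w_def)
      have "X ^ (2 * n + 2) = (X\<^sup>2) ^ (n + 1)"
        unfolding power_mult[symmetric] by simp
      also have "X\<^sup>2 = 4 / w\<^sup>2" by (simp add: X_def w_def power_divide)
      also have "(4 / w\<^sup>2) ^ (n + 1) = 4 ^ (n + 1) / (w ^ n * w ^ (n + 2))"
      proof -
        have "(w\<^sup>2) ^ (n + 1) = w ^ n * w ^ (n + 2)"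
          unfolding power_mult[symmetric] power_add[symmetric] by (simp add: mult_2)
        then show ?thesis by (simp add: power_divide)
      qed
      finally show ?thesis using w unfolding w_def[symmetric] by simp
    qed
    finally show "(\<integral>\<^sup>+x\<in>{0<..}. (ennreal (norm (Complex x (x * t)) ^ (2 * n)) * indicator (ball 1 1) (Complex x (x * t))) * ennreal x \<partial>lborel)
       = ennreal (4 ^ (n + 1) / (2 * n + 2)) * ennreal (1 / (1 + t\<^sup>2) ^ (n + 1 + 1))"
      by (simp add: ennreal_mult'[symmetric])
  qed
  also have "\<dots> = ennreal (4 ^ (n + 1) / (2 * n + 2)) * ennreal (pi * fact (2 * (n + 1)) / (4 ^ (n + 1) * (fact (n + 1))\<^sup>2))"
    by (subst nn_integral_cmult) (simp_all only: nn_integral_inverse_one_plus_square_power, measurable)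
  also have "\<dots> = ennreal (4 ^ (n + 1) / (2 * n + 2) * (pi * fact (2 * (n + 1)) / (4 ^ (n + 1) * (fact (n + 1))\<^sup>2)))"
    by (rule ennreal_mult'[symmetric]) simp
  also have "4 ^ (n + 1) / (2 * n + 2) * (pi * fact (2 * (n + 1)) / (4 ^ (n + 1) * (fact (n + 1))\<^sup>2))
      = pi * fact (2 * n + 1) / (fact (n + 1))\<^sup>2"
  proof -
    have "fact (2 * (n + 1)) = (2 * real n + 2) * fact (2 * n + 1)"
      using fact_Suc[of "2 * n + 1", where ?'a = real] by simp
    moreover have "p / m * (pi * (m * f) / (p * g)) = pi * f / g" if "p > 0" "m > 0" for p m f g :: real
      using that by (cases "g = 0") (auto simp: field_simps)
    then have "4 ^ (n + 1) / (2 * real n + 2) * (pi * ((2 * real n + 2) * fact (2 * n + 1)) / (4 ^ (n + 1) * (fact (n + 1))\<^sup>2))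
      = pi * fact (2 * n + 1) / (fact (n + 1))\<^sup>2" by simp
    moreover have "real (2 * n + 2) = 2 * real n + 2" by simp
    ultimately show ?thesis by (simp only:)
  qed
  finally show ?thesis .
qed

(* Re (1 / w) > 1 / (2 a) holds exactly on the disc of radius a about a, and the area of that disc
   will be chosen equal to the area of the given set. *)
lemma nn_integral_Re_inverse_excess:
  assumes a: "a > 0"
  shows "(\<integral>\<^sup>+w. ennreal (Re (1 / w) - 1 / (2 * a)) \<partial>lborel) = ennreal (pi * a / 2)"
proof -
  have pos: "1 + t\<^sup>2 > 0" for t :: real by (simp add: add_pos_nonneg)
  have "(\<integral>\<^sup>+w. ennreal (Re (1 / w) - 1 / (2 * a)) \<partial>lborel)
     = (\<integral>\<^sup>+t. (\<integral>\<^sup>+x\<in>{0<..}. ennreal (Re (1 / Complex x (x * t)) - 1 / (2 * a)) * ennreal x \<partial>lborel) \<partial>lborel)"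
  proof (rule nn_integral_complex_slopes)
    fix z :: complex assume "Re z \<le> 0"
    then have "Re (1 / z) \<le> 0" by (simp add: Re_divide divide_le_0_iff)
    moreover have "1 / (2 * a) > 0" using a by simp
    ultimately have "Re (1 / z) - 1 / (2 * a) \<le> 0" by linarith
    then show "ennreal (Re (1 / z) - 1 / (2 * a)) = 0" by (rule ennreal_neg)
  qed measurable
  also have "\<dots> = (\<integral>\<^sup>+t. ennreal a * ennreal (1 / (1 + t\<^sup>2) ^ (1 + 1)) \<partial>lborel)"
  proof (rule nn_integral_cong)
    fix t :: real
    define c where "c = 1 / (1 + t\<^sup>2)"
    have c: "c > 0" using pos[of t] by (simp add: c_def)
    have "(\<integral>\<^sup>+x\<in>{0<..}. ennreal (Re (1 / Complex x (x * t)) - 1 / (2 * a)) * ennreal x \<partial>lborel)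
        = (\<integral>\<^sup>+x. ennreal (c - x / (2 * a)) * indicator {0<..<2 * a * c} x \<partial>lborel)"
    proof (rule nn_integral_cong)
      fix x :: real
      show "ennreal (Re (1 / Complex x (x * t)) - 1 / (2 * a)) * ennreal x * indicator {0<..} x
          = ennreal (c - x / (2 * a)) * indicator {0<..<2 * a * c} x"
      proof (cases "x > 0")
        case True
        have "Re (1 / Complex x (x * t)) = x / (x\<^sup>2 * (1 + t\<^sup>2))"
          by (simp add: Re_divide power_mult_distrib algebra_simps)
        also have "\<dots> = c / x" using True by (simp add: c_def power2_eq_square)
        finally have "ennreal (Re (1 / Complex x (x * t)) - 1 / (2 * a)) * ennreal x = ennreal ((c / x - 1 / (2 * a)) * x)"
          using True by (simp add: ennreal_mult'')
        also have "(c / x - 1 / (2 * a)) * x = c - x / (2 * a)" using True by (simp add: field_simps)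
        finally have eq: "ennreal (Re (1 / Complex x (x * t)) - 1 / (2 * a)) * ennreal x = ennreal (c - x / (2 * a))" .
        have "ennreal (c - x / (2 * a)) = 0" if "x \<ge> 2 * a * c"
          using that a by (intro ennreal_neg) (simp add: field_simps)
        then show ?thesis using eq True by (auto simp: indicator_def)
      qed simp
    qed
    also have "\<dots> = ennreal ((c * (2 * a * c) - (2 * a * c)\<^sup>2 / (4 * a)) - (c * 0 - 0\<^sup>2 / (4 * a)))"
      using a c by (intro nn_integral_has_integral_Ioo) (auto intro!: derivative_eq_intros simp: field_simps)
    also have "(c * (2 * a * c) - (2 * a * c)\<^sup>2 / (4 * a)) - (c * 0 - 0\<^sup>2 / (4 * a)) = a * (1 / (1 + t\<^sup>2) ^ (1 + 1))"
    proof -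
      have "1 / (1 + t\<^sup>2) ^ (1 + 1) = c\<^sup>2" by (simp add: c_def power2_eq_square)
      then show ?thesis using a by (simp add: power2_eq_square field_simps)
    qed
    finally show "(\<integral>\<^sup>+x\<in>{0<..}. ennreal (Re (1 / Complex x (x * t)) - 1 / (2 * a)) * ennreal x \<partial>lborel)
        = ennreal a * ennreal (1 / (1 + t\<^sup>2) ^ (1 + 1))"
      using a by (simp add: ennreal_mult'[symmetric])
  qed
  also have "\<dots> = ennreal a * ennreal (pi * fact (2 * 1) / (4 ^ 1 * (fact 1)\<^sup>2))"
    by (subst nn_integral_cmult) (simp_all only: nn_integral_inverse_one_plus_square_power, measurable)
  also have "\<dots> = ennreal (pi * a / 2)"
    using a by (simp add: ennreal_mult'[symmetric] field_simps)
  finally show ?thesis .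
qed

subsection \<open>Cauchy transforms and one-variable sublevel sets\<close>

text \<open>The abstract measure and the map \<open>f\<close> let one lemma serve both area on a
  plane set and length on a real set embedded in the plane. Differentiation under the integral is
  explicit: the error of the difference quotient has integrand (y - z) / ((f - y) (f - z)^2), which
  is at most 2 |y - z| / d^3 in modulus once y is within d/2 of z.\<close>

lemma holomorphic_on_Cauchy_transform:
  fixes f :: "'a \<Rightarrow> complex"
  assumes "finite_measure M" and f[measurable]: "f \<in> borel_measurable M"
    and K: "closed K" and fK: "\<And>x. x \<in> space M \<Longrightarrow> f x \<in> K"
  shows "(\<lambda>z. \<integral>x. 1 / (f x - z) \<partial>M) holomorphic_on - K"
proof -
  interpret finite_measure M by fact
  define g where "g z = (\<integral>x. 1 / (f x - z) \<partial>M)" for z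
  have "\<exists>D. (g has_field_derivative D) (at z)" if z: "z \<notin> K" for z
  proof -
    obtain d where d: "d > 0" "ball z d \<subseteq> - K"
      using z K open_contains_ball[of "- K"] by (auto simp: open_Compl)
    have fd: "d \<le> norm (f x - z)" if "x \<in> space M" for x
      using d(2) fK[OF that] by (force simp: dist_norm norm_minus_commute)
    define D where "D = (\<integral>x. 1 / (f x - z)\<^sup>2 \<partial>M)"
    define B where "B = 2 / d ^ 3 * measure M (space M)"
    have near: "norm ((g y - g z) / (y - z) - D) \<le> B * norm (y - z)"
      if y: "y \<noteq> z" "norm (y - z) < d / 2" for y
    proof -
      have fy: "d / 2 \<le> norm (f x - y)" if "x \<in> space M" for x
        using fd[OF that] y(2) norm_triangle_ineq[of "f x - y" "y - z"] by simp
      have nz: "f x - y \<noteq> 0" "f x - z \<noteq> 0" if "x \<in> space M" for x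
        using fd[OF that] fy[OF that] d(1) by auto
      have int1: "integrable M (\<lambda>x. 1 / (f x - y))"
        using fy d(1) by (intro integrable_const_bound[of _ "2 / d"])
          (auto simp: norm_divide intro!: AE_I2 divide_le_eq[THEN iffD2] simp: field_simps)
      have int2: "integrable M (\<lambda>x. 1 / (f x - z))"
        using fd d(1) by (intro integrable_const_bound[of _ "1 / d"])
          (auto simp: norm_divide intro!: AE_I2 divide_left_mono mult_pos_pos dest: nz)
      have int3: "integrable M (\<lambda>x. 1 / (f x - z)\<^sup>2)"
        using fd d(1) by (intro integrable_const_bound[of _ "1 / d\<^sup>2"])
          (auto simp: norm_divide norm_power intro!: AE_I2 divide_left_mono power_mono mult_pos_pos dest: nz)
      have "(g y - g z) / (y - z) - D
          = (\<integral>x. (1 / (f x - y) - 1 / (f x - z)) / (y - z) - 1 / (f x - z)\<^sup>2 \<partial>M)"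
        unfolding g_def D_def using int1 int2 int3 by simp
      also have "\<dots> = (\<integral>x. (y - z) / ((f x - y) * (f x - z)\<^sup>2) \<partial>M)"
      proof (rule Bochner_Integration.integral_cong[OF refl])
        fix x assume "x \<in> space M"
        have "(1 / a - 1 / b) / (b - a) - 1 / b\<^sup>2 = (b - a) / (a * b\<^sup>2)"
          if "a \<noteq> 0" "b \<noteq> 0" "b - a \<noteq> 0" for a b :: complex
          using that by (simp add: divide_simps power2_eq_square)
        from this[of "f x - y" "f x - z"] show "(1 / (f x - y) - 1 / (f x - z)) / (y - z) - 1 / (f x - z)\<^sup>2 = (y - z) / ((f x - y) * (f x - z)\<^sup>2)"
          using nz[OF \<open>x \<in> space M\<close>] y(1) by simp
      qed
      also have "norm \<dots> \<le> (\<integral>x. norm ((y - z) / ((f x - y) * (f x - z)\<^sup>2)) \<partial>M)"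
        by (rule integral_norm_bound)
      also have "\<dots> \<le> (\<integral>x. norm (y - z) * (2 / d ^ 3) \<partial>M)"
      proof (rule Bochner_Integration.integral_mono')
        fix x assume x: "x \<in> space M"
        have "d / 2 * d\<^sup>2 \<le> norm (f x - y) * (norm (f x - z))\<^sup>2"
          using fd[OF x] fy[OF x] d(1) by (intro mult_mono power_mono) auto
        then have "norm (y - z) / (norm (f x - y) * (norm (f x - z))\<^sup>2) \<le> norm (y - z) / (d / 2 * d\<^sup>2)"
          using d(1) nz[OF x] by (intro divide_left_mono) auto
        then show "norm ((y - z) / ((f x - y) * (f x - z)\<^sup>2)) \<le> norm (y - z) * (2 / d ^ 3)"
          by (simp add: norm_divide norm_mult norm_power power2_eq_square power3_eq_cube)
      qed (use d in auto)
      also have "\<dots> = B * norm (y - z)" by (simp add: B_def)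
      finally show ?thesis .
    qed
    have "((\<lambda>y. (g y - g z) / (y - z) - D) \<longlongrightarrow> 0) (at z)"
    proof (rule Lim_null_comparison)
      show "\<forall>\<^sub>F y in at z. norm ((g y - g z) / (y - z) - D) \<le> B * norm (y - z)"
        unfolding eventually_at using near d(1) by (intro exI[of _ "d / 2"]) (auto simp: dist_norm)
      show "((\<lambda>y. B * norm (y - z)) \<longlongrightarrow> 0) (at z)" by (auto intro!: tendsto_eq_intros)
    qed
    then have "(g has_field_derivative D) (at z)"
      unfolding has_field_derivative_iff by (simp add: LIM_zero_iff)
    then show ?thesis ..
  qed
  then show ?thesis
    unfolding g_def[symmetric] using K
    by (simp add: holomorphic_on_open open_Compl)
qed

text \<open>After a rotation that makes the integral real, this is a bathtub argument: among sets of
  area k, the integral of Re (theta / (w - z)) is largest on a superlevel set, which is a disc.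
  Subtracting the threshold 1 / (2 a) and keeping only the positive part bounds the integral over
  \<open>K\<close> by pi a / 2; adding back k / (2 a) = pi a / 2 gives pi a = sqrt (pi k).\<close>

lemma Ahlfors_Beurling:
  fixes K :: "complex set"
  assumes K: "compact K" and z: "z \<notin> K"
  shows "norm (\<integral>w. 1 / (w - z) \<partial>restrict_space lborel K) \<le> sqrt (pi * measure lborel K)"
proof -
  define M where "M = restrict_space lborel K"
  define I where "I = (\<integral>w. 1 / (w - z) \<partial>M)"
  define k where "k = measure lborel K"
  have Kb [measurable]: "K \<in> sets borel" using K by (simp add: borel_compact)
  have fin: "emeasure lborel K < \<infinity>" using K by (rule emeasure_compact_finite)
  have spM: "space M = K" by (simp add: M_def space_restrict_space)
  have kM: "measure M (space M) = k" unfolding spM M_def k_def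
    by (simp add: measure_restrict_space)
  interpret M: finite_measure M
    using fin by (intro finite_measureI) (simp add: spM M_def emeasure_restrict_space)
  have meas: "f \<in> borel_measurable borel \<Longrightarrow> f \<in> borel_measurable M" for f :: "complex \<Rightarrow> 'b::topological_space"
    unfolding M_def by (intro measurable_restrict_space1) simp
  obtain d where d: "d > 0" "\<And>w. w \<in> K \<Longrightarrow> d \<le> dist z w"
    using separate_point_closed[of K z] K z compact_imp_closed by blast
  have int: "integrable M (\<lambda>w. 1 / (w - z))"
  proof (rule M.integrable_const_bound[of _ "1 / d"])
    show "AE w in M. norm (1 / (w - z)) \<le> 1 / d"
    proof (rule AE_I2)
      fix w assume "w \<in> space M"
      then have "d \<le> norm (w - z)" using d(2)[of w] by (simp add: spM dist_norm norm_minus_commute)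
      then show "norm (1 / (w - z)) \<le> 1 / d" using d(1) by (simp add: norm_divide frac_le)
    qed
  qed (auto intro!: meas)
  show ?thesis
  proof (cases "I = 0 \<or> k = 0")
    case True
    then show ?thesis
    proof
      assume "k = 0"
      then have "emeasure M (space M) = 0" using M.emeasure_eq_measure kM by simp
      then have "space M \<in> null_sets M" by auto
      then have "AE w in M. 1 / (w - z) = 0" by (rule AE_I') auto
      then have "I = 0" unfolding I_def by (rule integral_eq_zero_AE)
      then show ?thesis by (simp add: I_def M_def)
    qed (simp add: I_def M_def)
  next
    case False
    then have k: "k > 0" and I0: "I \<noteq> 0" by (auto simp: k_def less_le)
    \<comment> \<open>The radius of a disc of area \<open>k\<close>.\<close>
    define a where "a = sqrt (k / pi)"
    have a: "a > 0" "pi * a\<^sup>2 = k" using k by (auto simp: a_def)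
    define \<theta> where "\<theta> = cnj I / norm I"
    have \<theta>: "norm \<theta> = 1" "\<theta> \<noteq> 0" using I0 by (auto simp: \<theta>_def norm_divide)
    have "norm I = Re (\<theta> * I)"
    proof -
      have "cnj I * I = of_real ((norm I)\<^sup>2)" by (metis complex_norm_square mult.commute)
      then have "\<theta> * I = of_real ((norm I)\<^sup>2) / of_real (norm I)" by (simp add: \<theta>_def)
      also have "\<dots> = of_real (norm I)" using I0 by (simp add: power2_eq_square)
      finally show ?thesis by simp
    qed
    also have "\<theta> * I = (\<integral>w. \<theta> / (w - z) \<partial>M)"
      using integral_mult_right_zero[of M \<theta> "\<lambda>w. 1 / (w - z)"] by (simp add: I_def)
    also have "Re \<dots> = (\<integral>w. Re (\<theta> / (w - z)) \<partial>M)"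
      using integrable_mult_right[OF int, of \<theta>] by (intro integral_Re[symmetric]) simp
    also have "\<dots> = (\<integral>w. Re (\<theta> / (w - z)) - 1 / (2 * a) \<partial>M) + k / (2 * a)"
    proof -
      have "integrable M (\<lambda>w. Re (\<theta> * (1 / (w - z))))"
        by (intro integrable_Re integrable_mult_right int)
      then show ?thesis by (simp add: kM)
    qed
    also have "(\<integral>w. Re (\<theta> / (w - z)) - 1 / (2 * a) \<partial>M) \<le> pi * a / 2"
    proof -
      define f where "f w = Re (\<theta> / (w - z)) - 1 / (2 * a)" for w
      have fm [measurable]: "f \<in> borel_measurable borel" unfolding f_def by measurable
      have "integrable M (\<lambda>w. Re (\<theta> * (1 / (w - z))))"
        by (intro integrable_Re integrable_mult_right int)
      then have fint: "integrable M f"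
        unfolding f_def by (intro Bochner_Integration.integrable_diff) auto
      have "(\<integral>\<^sup>+w. ennreal (f w) \<partial>M) \<le> (\<integral>\<^sup>+w. ennreal (f w) \<partial>lborel)"
        unfolding M_def by (subst nn_integral_restrict_space)
          (auto intro!: nn_integral_mono split: split_indicator)
      also have "\<dots> = (\<integral>\<^sup>+w. ennreal (f w) \<partial>distr lborel borel ((+) z))" by (simp add: lborel_distr_plus)
      also have "\<dots> = (\<integral>\<^sup>+w. ennreal (f (z + w)) \<partial>lborel)" by (rule nn_integral_distr) auto
      also have "\<dots> = ennreal (1 ^ DIM(complex)) * (\<integral>\<^sup>+w. ennreal (f (z + \<theta> * w)) \<partial>lborel)"
        by (rule nn_integral_lborel_similarity[symmetric])
          (auto simp: norm_mult \<theta> intro: bounded_linear.linear[OF bounded_linear_mult_right])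
      also have "(\<lambda>w. ennreal (f (z + \<theta> * w))) = (\<lambda>w. ennreal (Re (1 / w) - 1 / (2 * a)))"
        using \<theta>(2) by (simp add: f_def)
      also have "(\<integral>\<^sup>+w. ennreal (Re (1 / w) - 1 / (2 * a)) \<partial>lborel) = ennreal (pi * a / 2)"
        by (rule nn_integral_Re_inverse_excess[OF a(1)])
      finally have le: "(\<integral>\<^sup>+w. ennreal (f w) \<partial>M) \<le> ennreal (pi * a / 2)" by simp
      have "(\<integral>w. f w \<partial>M) \<le> enn2real (\<integral>\<^sup>+w. ennreal (f w) \<partial>M)"
        using real_lebesgue_integral_def[OF fint] enn2real_nonneg by simp
      also have "\<dots> \<le> pi * a / 2"
        using enn2real_mono[OF le] a(1) by simp
      finally show ?thesis by (simp add: f_def)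
    qed
    also have "pi * a / 2 + k / (2 * a) = pi * a"
      using a by (simp add: field_simps power2_eq_square)
    also have "pi * a = sqrt (pi * k)"
      using a by (intro real_sqrt_unique[symmetric]) (auto simp: power2_eq_square mult_ac)
    finally show ?thesis by (simp add: I_def M_def k_def)
  qed
qed

text \<open>Sublevel sets of an upper semicontinuous function need not be closed, while the
  holomorphic functions used below live off a compact set. Inner regularity bridges this; it is
  applied to Lebesgue measure cut down to \<open>S\<close>, which is finite.\<close>

lemma emeasure_lborel_le_compact:
  fixes S :: "'a::euclidean_space set"
  assumes S: "S \<in> sets borel" "bounded S"
    and le: "\<And>K. compact K \<Longrightarrow> K \<subseteq> S \<Longrightarrow> emeasure lborel K \<le> b"
  shows "emeasure lborel S \<le> b"
proof -
  define M where "M = density lborel (indicator S)"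
  note [measurable] = S(1)
  have M: "emeasure M A = emeasure lborel (S \<inter> A)" if "A \<in> sets borel" for A
    using that unfolding M_def by (simp add: emeasure_density indicator_inter_arith[symmetric])
  have "space M = UNIV" by (simp add: M_def)
  then have "emeasure M (space M) \<noteq> \<infinity>"
    using emeasure_bounded_finite[OF S(2)] M[of UNIV] by simp
  then have "emeasure M S = (SUP K \<in> {K. K \<subseteq> S \<and> compact K}. emeasure M K)"
    using S(1) by (intro inner_regular) (auto simp: M_def)
  also have "\<dots> \<le> b"
  proof (rule SUP_least)
    fix K assume "K \<in> {K. K \<subseteq> S \<and> compact K}"
    then have "K \<subseteq> S" "compact K" by auto
    then show "emeasure M K \<le> b"
      using le[of K] M[of K] by (simp add: borel_compact Int_absorb1)
  qed
  finally show ?thesis using M[OF S(1)] by simp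
qed

text \<open>Because 0 is on the boundary of the disc, Re (c / w) >= 1/2 on it and nothing cancels in
  the transform at 0. Hence |F 0| >= k / (2 |c| sqrt (pi k)), whereas the maximum principle and u 0
  >= 0 give |F 0| <= e^(-s). Squaring and cancelling one factor k leaves the bound.\<close>

lemma sublevel_area_disc:
  assumes sub: "subharmonic u" and uC: "\<And>z. R0 \<le> norm z \<Longrightarrow> u z \<le> ereal (ln (norm z) + C)"
    and u0: "0 \<le> u 0" and s: "s > 0"
    and S: "S \<in> sets borel" "S \<subseteq> cball c (norm c)" and uS: "\<And>z. z \<in> S \<Longrightarrow> u z \<le> ereal (- s)"
  shows "emeasure lborel S \<le> ennreal (4 * pi * (norm c)\<^sup>2 * exp (- 2 * s))"
proof (rule emeasure_lborel_le_compact[OF S(1)])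
  show "bounded S" using S(2) bounded_cball bounded_subset by blast
  fix K assume K: "compact K" "K \<subseteq> S"
  define k where "k = measure lborel K"
  have fin: "emeasure lborel K = ennreal k"
    using emeasure_compact_finite[OF K(1)] by (simp add: k_def emeasure_eq_ennreal_measure less_top[symmetric])
  have Kb [measurable]: "K \<in> sets borel" using K by (simp add: borel_compact)
  have K0: "0 \<notin> K"
  proof
    assume "0 \<in> K"
    then have "u 0 \<le> ereal (- s)" using uS[of 0] K(2) by auto
    with u0 have "0 \<le> ereal (- s)" by (rule order_trans)
    then show False using s by simp
  qed
  have "k \<le> 4 * pi * (norm c)\<^sup>2 * exp (- 2 * s)"
  proof (cases "k = 0")
    case False
    then have k: "k > 0" by (simp add: k_def less_le)
    define M where "M = restrict_space lborel K"
    have spM: "space M = K" by (simp add: M_def space_restrict_space)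
    have kM: "measure M (space M) = k" unfolding spM M_def k_def
      by (simp add: measure_restrict_space)
    interpret M: finite_measure M
      by (intro finite_measureI) (simp add: spM M_def emeasure_restrict_space fin)
    have meas [measurable]: "f \<in> borel_measurable borel \<Longrightarrow> f \<in> borel_measurable M" for f :: "complex \<Rightarrow> complex"
      unfolding M_def by (intro measurable_restrict_space1) simp
    define F where "F z = (\<integral>w. 1 / (w - z) \<partial>M) / of_real (sqrt (pi * k))" for z
    have pk: "sqrt (pi * k) > 0" using k by simp
    obtain B where B: "B > 0" "\<And>w. w \<in> K \<Longrightarrow> norm w \<le> B"
      using compact_imp_bounded[OF K(1)] bounded_pos by blast
    have c: "c \<noteq> 0"
    proof
      assume "c = 0"
      then have "K \<subseteq> {0}" using K(2) S(2) by auto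
      then have "emeasure lborel K \<le> emeasure lborel {0::complex}" by (intro emeasure_mono) auto
      then show False using fin k by simp
    qed
    have norm_F: "norm (F z) = norm (\<integral>w. 1 / (w - z) \<partial>M) / sqrt (pi * k)" for z
      using pk by (simp add: F_def norm_divide)
    obtain d where d: "d > 0" "\<And>w. w \<in> K \<Longrightarrow> d \<le> dist 0 w"
      using separate_point_closed[of K 0] K0 K(1) compact_imp_closed by blast
    have int: "integrable M (\<lambda>w. c / w)"
      using d by (intro M.integrable_const_bound[of _ "norm c / d"])
        (auto simp: spM norm_divide intro!: AE_I2 frac_le)
    have "k / 2 = (\<integral>w. 1 / 2 \<partial>M)" by (simp add: kM)
    also have "\<dots> \<le> (\<integral>w. Re (c / w) \<partial>M)"
    proof (rule integral_mono)
      fix w assume "w \<in> space M"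
      then have w: "w \<in> K" "w \<noteq> 0" using K0 by (auto simp: spM)
      \<comment> \<open>The inequality |w - c| <= |c|, once squared, reads |w|^2 <= 2 Re (c cnj w),
        that is Re (c / w) >= 1/2.\<close>
      then have "(norm (w - c))\<^sup>2 \<le> (norm c)\<^sup>2"
        using K(2) S(2) by (intro power_mono) (auto simp: dist_norm norm_minus_commute)
      then have "(norm w)\<^sup>2 \<le> 2 * (Re c * Re w + Im c * Im w)"
        unfolding cmod_power2 by (simp add: power2_eq_square algebra_simps)
      moreover have "(norm w)\<^sup>2 > 0" using w by simp
      ultimately show "1 / 2 \<le> Re (c / w)" by (simp add: Re_divide cmod_power2 field_simps)
    qed (use int in auto)
    also have "\<dots> = Re (\<integral>w. c / w \<partial>M)" using int by (rule integral_Re)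
    also have "\<dots> \<le> norm (\<integral>w. c / w \<partial>M)" by (rule complex_Re_le_cmod)
    also have "(\<integral>w. c / w \<partial>M) = c * (\<integral>w. 1 / w \<partial>M)"
      using integral_mult_right_zero[of M c "\<lambda>w. 1 / w"] by simp
    finally have "k / 2 \<le> norm c * (norm (F 0) * sqrt (pi * k))" using pk by (simp add: norm_mult norm_F)
    then have F0: "k \<le> 2 * norm c * sqrt (pi * k) * norm (F 0)" by (simp add: mult_ac)
    then have F0': "F 0 \<noteq> 0" using k by auto
    have "u 0 \<le> ereal (- s - ln (norm (F 0)))"
    proof (rule subharmonic_le_minus_ln_norm[where F = F and a = 0, OF sub K(1) _ _ _ _ _ K0 F0'])
      show "F holomorphic_on - K"
        unfolding F_def using pk compact_imp_closed[OF K(1)]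
        by (intro holomorphic_intros holomorphic_on_Cauchy_transform M.finite_measure_axioms) (auto simp: spM)
      show "norm (F z) \<le> 1" if "z \<notin> K" for z
        using Ahlfors_Beurling[OF K(1) that] pk by (simp add: norm_F M_def k_def)
      \<comment> \<open>Beyond twice the radius of \<open>K\<close> one has |w - z| >= |z| / 2. The
        size of the numerator does not influence the final bound.\<close>
      show "norm (F z) \<le> (2 * k / sqrt (pi * k)) / norm z" if "max R0 (2 * B) \<le> norm z" "z \<notin> K" for z
      proof -
        have "2 * B \<le> norm z" using that(1) by simp
        then have z: "norm z > 0" using B(1) by linarith
        have "norm (\<integral>w. 1 / (w - z) \<partial>M) \<le> (\<integral>w. norm (1 / (w - z)) \<partial>M)" by (rule integral_norm_bound)
        also have "\<dots> \<le> (\<integral>w. 2 / norm z \<partial>M)"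
        proof (rule integral_mono')
          fix w assume "w \<in> space M"
          then have "norm z / 2 \<le> norm (w - z)"
            using B(2)[of w] that(1) norm_triangle_ineq2[of z w] by (simp add: spM norm_minus_commute)
          then have "1 / norm (w - z) \<le> 1 / (norm z / 2)" using z by (intro frac_le) auto
          then show "norm (1 / (w - z)) \<le> 2 / norm z" by (simp add: norm_divide)
        qed auto
        also have "\<dots> = 2 * k / norm z" by (simp add: kM)
        finally have "norm (F z) \<le> (2 * k / norm z) / sqrt (pi * k)"
          unfolding norm_F using pk by (intro divide_right_mono) auto
        then show ?thesis by (simp add: mult.commute)
      qed
      show "u z \<le> ereal (- s)" if "z \<in> K" for z using uS K(2) that by auto
      show "u z \<le> ereal (ln (norm z) + C)" if "max R0 (2 * B) \<le> norm z" for z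
        using uC[of z] that by simp
    qed
    with u0 have "0 \<le> ereal (- s - ln (norm (F 0)))" by (rule order_trans)
    then have "ln (norm (F 0)) \<le> - s" by simp
    then have "norm (F 0) \<le> exp (- s)" using F0' by (metis exp_le_cancel_iff exp_ln zero_less_norm_iff)
    then have "2 * norm c * sqrt (pi * k) * norm (F 0) \<le> 2 * norm c * sqrt (pi * k) * exp (- s)"
      using pk by (intro mult_left_mono mult_nonneg_nonneg) auto
    with F0 have "k \<le> 2 * norm c * sqrt (pi * k) * exp (- s)" by linarith
    then have "k\<^sup>2 \<le> (2 * norm c * sqrt (pi * k) * exp (- s))\<^sup>2" using k by (intro power_mono) auto
    also have "\<dots> = k * (4 * pi * (norm c)\<^sup>2 * exp (- 2 * s))"
      using k by (simp add: power_mult_distrib exp_double[symmetric])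
    finally show ?thesis using k by (simp add: power2_eq_square)
  qed simp
  then show "emeasure lborel K \<le> ennreal (4 * pi * (norm c)\<^sup>2 * exp (- 2 * s))"
    unfolding fin by (rule ennreal_leI)
qed

text \<open>Off the real axis the imaginary part of 1 / (x - z) has constant sign and is, up to
  sign, the kernel y / ((x - Re z)^2 + y^2). Its integral over the segment is the angle under which
  the segment is seen from z, a difference of two arctangents and hence strictly below pi;
  strictness later gives a positive cosine.\<close>

lemma abs_Im_segment_transform_less:
  fixes K :: "real set"
  assumes K: "compact K" "K \<subseteq> {0..l}" and z: "z \<notin> of_real ` K"
    and int: "integrable (restrict_space lborel K) (\<lambda>x. 1 / (of_real x - z))"
  shows "\<bar>Im (\<integral>x. 1 / (of_real x - z) \<partial>restrict_space lborel K)\<bar> < pi"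
proof (cases "Im z = 0")
  case True
  have "Im (1 / (of_real x - z)) = 0" for x using True by (simp add: Im_divide)
  then have "Im (\<integral>x. 1 / (of_real x - z) \<partial>restrict_space lborel K) = 0"
    by (simp only: integral_Im[OF int, symmetric]) simp
  then show ?thesis by simp
next
  case False
  have [measurable]: "K \<in> sets borel" using K by (simp add: borel_compact)
  show ?thesis
  proof (cases "l \<ge> 0")
    case True
    define y where "y = \<bar>Im z\<bar>"
    have y: "y > 0" using False by (simp add: y_def)
    define h where "h x = y / ((x - Re z)\<^sup>2 + y\<^sup>2)" for x
    have den: "(x - Re z)\<^sup>2 + y\<^sup>2 > 0" for x using y by (simp add: add_nonneg_pos)
    have h0: "h x \<ge> 0" for x using y den[of x] by (simp add: h_def)
    have [measurable]: "h \<in> borel_measurable borel" unfolding h_def by measurable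
    have absIm: "\<bar>Im (1 / (of_real x - z))\<bar> = h x" for x
      using den[of x] by (simp add: Im_divide h_def y_def abs_divide)
    define A where "A = arctan ((l - Re z) / y) - arctan ((0 - Re z) / y)"
    have "A < pi"
      using arctan_bounded[of "(l - Re z) / y"] arctan_bounded[of "(0 - Re z) / y"] unfolding A_def by linarith
    have "(0 - Re z) / y \<le> (l - Re z) / y" using True y by (intro divide_right_mono) auto
    then have A0: "A \<ge> 0" unfolding A_def by (simp only: arctan_le_iff diff_ge_0_iff_ge)
    have "(h has_integral A) {0..l}"
      unfolding A_def
    proof (rule fundamental_theorem_of_calculus[OF True])
      fix x assume "x \<in> {0..l}"
      have "((\<lambda>x. arctan ((x - Re z) / y)) has_real_derivative inverse (1 + ((x - Re z) / y)\<^sup>2) * (1 / y)) (at x)"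
        using y by (auto intro!: derivative_eq_intros)
      also have "inverse (1 + ((x - Re z) / y)\<^sup>2) * (1 / y) = h x"
        using y den[of x] by (simp add: h_def divide_simps power2_eq_square)
      finally show "((\<lambda>x. arctan ((x - Re z) / y)) has_vector_derivative h x) (at x within {0..l})"
        unfolding has_real_derivative_iff_has_vector_derivative[symmetric]
        by (rule has_field_derivative_at_within)
    qed
    then have hA: "(\<integral>\<^sup>+x. ennreal (h x) * indicator {0..l} x \<partial>lborel) = ennreal A"
      using h0 by (intro nn_integral_has_integral_lebesgue') auto
    have "ennreal (norm (\<integral>x. Im (1 / (of_real x - z)) \<partial>restrict_space lborel K))
        \<le> (\<integral>\<^sup>+x. ennreal (norm (Im (1 / (of_real x - z)))) \<partial>restrict_space lborel K)"
      by (rule integral_norm_bound_ennreal) (intro integrable_Im int)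
    also have "\<dots> = (\<integral>\<^sup>+x. ennreal (h x) * indicator K x \<partial>lborel)"
      by (simp add: absIm nn_integral_restrict_space)
    also have "\<dots> \<le> (\<integral>\<^sup>+x. ennreal (h x) * indicator {0..l} x \<partial>lborel)"
      using K(2) by (intro nn_integral_mono) (auto split: split_indicator)
    finally have "\<bar>Im (\<integral>x. 1 / (of_real x - z) \<partial>restrict_space lborel K)\<bar> \<le> A"
      unfolding hA integral_Im[OF int] using A0 by simp
    then show ?thesis using \<open>A < pi\<close> by linarith
  next
    case False
    then have "K = {}" using K(2) by auto
    then have "(\<integral>x. 1 / (of_real x - z) \<partial>restrict_space lborel K) = 0"
      by (intro integral_eq_zero_AE AE_I2) (simp add: space_restrict_space)
    then show ?thesis by simp
  qed
qed

(* The point 0 must be an end point of the segment: with parts of S on both sides of 0 the integral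
   of 1 / x over S could cancel. *)
lemma sublevel_length_segment:
  assumes sub: "subharmonic u" and uC: "\<And>z. R0 \<le> norm z \<Longrightarrow> u z \<le> ereal (ln (norm z) + C)"
    and u0: "0 \<le> u 0" and s: "s > 0" and l: "l \<ge> 0"
    and S: "S \<in> sets borel" "S \<subseteq> {0..l}" and uS: "\<And>x. x \<in> S \<Longrightarrow> u (of_real x) \<le> ereal (- s)"
  shows "emeasure lborel S \<le> ennreal (8 * l * exp (- s))"
proof (rule emeasure_lborel_le_compact[OF S(1)])
  show "bounded S" using S(2) bounded_closed_interval bounded_subset by blast
  fix K assume K: "compact K" "K \<subseteq> S"
  have Kl: "K \<subseteq> {0..l}" using K(2) S(2) by auto
  define k where "k = measure lborel K"
  have fin: "emeasure lborel K = ennreal k"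
    using emeasure_compact_finite[OF K(1)] by (simp add: k_def emeasure_eq_ennreal_measure less_top[symmetric])
  have Kb [measurable]: "K \<in> sets borel" using K by (simp add: borel_compact)
  define K' where "K' = complex_of_real ` K"
  have cK': "compact K'"
    unfolding K'_def using K(1) by (intro compact_continuous_image continuous_intros)
  have K0: "0 \<notin> K'"
  proof
    assume "0 \<in> K'"
    then have "u 0 \<le> ereal (- s)" using uS[of 0] K(2) by (auto simp: K'_def)
    with u0 have "0 \<le> ereal (- s)" by (rule order_trans)
    then show False using s by simp
  qed
  have "k \<le> 8 * l * exp (- s)"
  proof (cases "k = 0")
    case True
    then show ?thesis using l by simp
  next
    case False
    then have k: "k > 0" by (simp add: k_def less_le)
    have "emeasure lborel K \<le> emeasure lborel {0..l}" by (rule emeasure_mono[OF Kl]) simp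
    then have kl: "k \<le> l" using l unfolding fin by simp
    with k have l: "l > 0" by simp
    define M where "M = restrict_space lborel K"
    have spM: "space M = K" by (simp add: M_def space_restrict_space)
    have kM: "measure M (space M) = k" unfolding spM M_def k_def
      by (simp add: measure_restrict_space)
    interpret M: finite_measure M
      by (intro finite_measureI) (simp add: spM M_def emeasure_restrict_space fin)
    have meas: "f \<in> borel_measurable borel \<Longrightarrow> f \<in> borel_measurable M" for f :: "real \<Rightarrow> 'b::topological_space"
      unfolding M_def by (intro measurable_restrict_space1) simp
    define I where "I z = (\<integral>x. 1 / (complex_of_real x - z) \<partial>M)" for z
    \<comment> \<open>This is tanh (I / 4): since |Im I| < pi, exp (I / 2) lies in the right
      half-plane, which the Cayley map sends into the unit disc, and F vanishes at infinity because
      I does.\<close>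
    define F where "F z = (exp (I z / 2) - 1) / (exp (I z / 2) + 1)" for z
    have int: "integrable M (\<lambda>x. 1 / (complex_of_real x - z))" if z: "z \<notin> K'" for z
    proof -
      obtain d where d: "d > 0" "\<And>w. w \<in> K' \<Longrightarrow> d \<le> dist z w"
        using separate_point_closed[of K' z] z cK' compact_imp_closed by blast
      show ?thesis
      proof (rule M.integrable_const_bound[of _ "1 / d"])
        show "AE x in M. norm (1 / (of_real x - z)) \<le> 1 / d"
        proof (rule AE_I2)
          fix x assume "x \<in> space M"
          then have "d \<le> norm (of_real x - z)" using d(2)[of "of_real x"] by (simp add: spM K'_def dist_norm norm_minus_commute)
          then show "norm (1 / (of_real x - z)) \<le> 1 / d" using d(1) by (simp add: norm_divide frac_le)
        qed
      qed (auto intro!: meas)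
    qed
    have Re_pos: "Re (exp (I z / 2)) > 0" if "z \<notin> K'" for z
    proof -
      have "\<bar>Im (I z)\<bar> < pi"
        using abs_Im_segment_transform_less[OF K(1) Kl, of z] int[OF that] that by (simp add: I_def M_def K'_def)
      then have "cos (Im (I z / 2)) > 0" by (intro cos_gt_zero_pi) auto
      then show ?thesis by (simp add: Re_exp)
    qed
    have "I holomorphic_on - K'"
      unfolding I_def using compact_imp_closed[OF cK']
      by (intro holomorphic_on_Cauchy_transform M.finite_measure_axioms) (auto simp: spM K'_def intro!: meas)
    moreover have "exp (I z / 2) + 1 \<noteq> 0" if "z \<in> - K'" for z
      using Re_pos[of z] that by (metis ComplD add_eq_0_iff2 less_minus_one_simps(1) not_less_iff_gr_or_eq one_complex.simps(1) uminus_complex.simps(1))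
    ultimately have F_holo: "F holomorphic_on - K'"
      unfolding F_def by (intro holomorphic_intros) auto
    have F1: "norm (F z) \<le> 1" if "z \<notin> K'" for z
    proof -
      define e where "e = exp (I z / 2)"
      have e: "Re e > 0" using Re_pos[OF that] by (simp add: e_def)
      have "(norm (e - 1))\<^sup>2 \<le> (norm (e + 1))\<^sup>2"
        unfolding cmod_power2 using e by (simp add: power2_eq_square algebra_simps)
      then have "norm (e - 1) \<le> norm (e + 1)" by (rule power2_le_imp_le) simp
      then show ?thesis
        unfolding F_def e_def[symmetric] norm_divide by (rule divide_le_eq_1[THEN iffD2, OF disjI1, OF conjI, rotated 1, OF _ ]) (use e in \<open>auto simp: complex_eq_iff\<close>)
    qed
    \<comment> \<open>The threshold 2 l gives |x - z| >= |z| / 2, and 2 k gives |I z| <= 1, so that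
      |exp (I / 2) - 1| <= 3/2 |I / 2|. The denominator has real part above 1.\<close>
    have FA: "norm (F z) \<le> 3 / 4 * (2 * k) / norm z" if "max R0 (max (2 * l) (2 * k)) \<le> norm z" "z \<notin> K'" for z
    proof -
      have "2 * l \<le> norm z" using that(1) by simp
      then have z: "norm z > 0" using l by linarith
      have "norm (I z) \<le> (\<integral>x. norm (1 / (of_real x - z)) \<partial>M)" unfolding I_def by (rule integral_norm_bound)
      also have "\<dots> \<le> (\<integral>x. 2 / norm z \<partial>M)"
      proof (rule integral_mono')
        fix x assume "x \<in> space M"
        then have "\<bar>x\<bar> \<le> l" using Kl by (auto simp: spM)
        then have "norm z / 2 \<le> norm (of_real x - z)"
          using that(1) norm_triangle_ineq2[of z "of_real x"] by (simp add: norm_minus_commute)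
        then have "1 / norm (of_real x - z) \<le> 1 / (norm z / 2)" using z by (intro frac_le) auto
        then show "norm (1 / (of_real x - z)) \<le> 2 / norm z" by (simp add: norm_divide)
      qed auto
      also have "\<dots> = 2 * k / norm z" by (simp add: kM)
      finally have I_le: "norm (I z) \<le> 2 * k / norm z" .
      also have "\<dots> \<le> 1" using that(1) z by simp
      finally have "norm (exp (I z / 2) - 1) \<le> 3 / 2 * norm (I z / 2)"
        by (intro norm_exp_bounds) (simp add: norm_divide)
      also have "\<dots> \<le> 3 / 4 * (2 * k / norm z)" using I_le by (simp add: norm_divide)
      finally have num: "norm (exp (I z / 2) - 1) \<le> 3 / 4 * (2 * k / norm z)" .
      have "1 \<le> Re (exp (I z / 2) + 1)" using Re_pos[OF that(2)] by simp
      then have den: "1 \<le> norm (exp (I z / 2) + 1)" using complex_Re_le_cmod order_trans by blast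
      have "norm (F z) \<le> norm (exp (I z / 2) - 1) / 1"
        unfolding F_def norm_divide using den by (intro divide_left_mono) auto
      then show ?thesis using num by simp
    qed
    define p where "p = Re (I 0) / 2"
    have I0: "I 0 = of_real (\<integral>x. 1 / x \<partial>M)"
      unfolding I_def by (subst integral_complex_of_real[symmetric]) (simp add: of_real_divide)
    then have Ip: "I 0 / 2 = of_real p" by (simp add: p_def)
    \<comment> \<open>Since \<open>K\<close> lies to the right of 0 within distance l, I 0 is real
      and at least k / l, so p >= q. Then F 0 = tanh (p / 2) >= tanh (q / 2) >= q / 4, because e^q -
      1 >= q and e^q + 1 <= 4. This q / 4 = k / (8 l) is the origin of the constant 8.\<close>
    define q where "q = k / (2 * l)"
    have q: "q > 0" "q \<le> 1 / 2" using k kl l by (auto simp: q_def field_simps)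
    have "k / l = (\<integral>x. 1 / l \<partial>M)" by (simp add: kM)
    also have "\<dots> \<le> (\<integral>x. 1 / x \<partial>M)"
    proof (rule integral_mono)
      have "integrable M (\<lambda>x. Re (1 / (of_real x - 0)))" by (intro integrable_Re int K0)
      moreover have "Re (1 / (of_real x - 0)) = 1 / x" for x
        using Re_complex_of_real[of "1 / x"] by (simp del: Re_complex_of_real)
      ultimately show "integrable M (\<lambda>x. 1 / x)" by (simp only:)
      fix x assume "x \<in> space M"
      then have "x \<in> K" by (simp add: spM)
      then have "0 < x" "x \<le> l" using Kl K0 by (auto simp: K'_def less_le)
      then show "1 / l \<le> 1 / x" by (intro divide_left_mono) auto
    qed auto
    finally have "q \<le> p" using l by (simp add: q_def p_def I0)
    have ep: "exp p > 0" "exp q > 0" "exp q \<le> exp p" using \<open>q \<le> p\<close> by auto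
    have "exp q \<le> 1 + q + q\<^sup>2" using q by (intro exp_bound) auto
    also have "\<dots> \<le> 3" using q power_mono[of q "1 / 2" 2] by (simp add: power2_eq_square)
    finally have eq3: "exp q \<le> 3" .
    have "k / (8 * l) = q / 4" using l by (simp add: q_def)
    also have "\<dots> \<le> q / (exp q + 1)" using eq3 q ep by (intro divide_left_mono mult_pos_pos add_pos_pos) auto
    also have "\<dots> \<le> (exp q - 1) / (exp q + 1)"
      using ep exp_ge_add_one_self[of q] by (intro divide_right_mono) linarith+
    also have "\<dots> \<le> (exp p - 1) / (exp p + 1)"
    proof -
      have "(x - 1) / (x + 1) \<le> (y - 1) / (y + 1)" if "0 < x" "x \<le> y" for x y :: real
        using that by (simp add: divide_simps) (simp add: algebra_simps)
      then show ?thesis using ep by simp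
    qed
    also have "\<dots> = norm (F 0)"
    proof -
      have "F 0 = of_real ((exp p - 1) / (exp p + 1))"
        unfolding F_def Ip by (simp add: exp_of_real)
      moreover have "0 \<le> (exp p - 1) / (exp p + 1)" using \<open>q \<le> p\<close> q ep by (intro divide_nonneg_pos add_pos_pos) auto
      ultimately show ?thesis by (simp only: norm_of_real abs_of_nonneg)
    qed
    finally have F0: "k / (8 * l) \<le> norm (F 0)" .
    then have F0': "F 0 \<noteq> 0" using k l by (auto simp: divide_le_0_iff)
    have "u 0 \<le> ereal (- s - ln (norm (F 0)))"
    proof (rule subharmonic_le_minus_ln_norm[where F = F and a = 0, OF sub cK' F_holo F1 FA _ _ K0 F0'])
      show "u z \<le> ereal (- s)" if "z \<in> K'" for z using uS K(2) that by (auto simp: K'_def)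
      show "u z \<le> ereal (ln (norm z) + C)" if "max R0 (max (2 * l) (2 * k)) \<le> norm z" for z
        using uC[of z] that by simp
    qed auto
    with u0 have "0 \<le> ereal (- s - ln (norm (F 0)))" by (rule order_trans)
    then have "ln (norm (F 0)) \<le> - s" by simp
    then have "norm (F 0) \<le> exp (- s)" using F0' by (metis exp_le_cancel_iff exp_ln zero_less_norm_iff)
    with F0 have "k / (8 * l) \<le> exp (- s)" by linarith
    then show ?thesis using l by (simp add: field_simps)
  qed
  then show "emeasure lborel K \<le> ennreal (8 * l * exp (- s))"
    unfolding fin by (rule ennreal_leI)
qed

subsection \<open>Integration over lines through the origin\<close>

text \<open>Polar coordinates for real and complex scalars at once, without a measure on the sphere.
  Averaging the slice integrals of f over directions in an annulus gives C times the integral of f,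
  by homogeneity of \<open>M\<close> of degree p. The same \<open>C\<close> occurs for
  \<open>K\<close> and \<open>B\<close>, so only 0 < C < infinity has to be known.\<close>

lemma slice_comparison:
  fixes M :: "'v::euclidean_space measure" and act :: "'s::euclidean_space \<Rightarrow> 'v \<Rightarrow> 'v"
  assumes sets: "sets M = sets borel" and "sigma_finite_measure M"
    and act: "(\<lambda>x. act (fst x) (snd x)) \<in> borel_measurable borel"
    and norm_act: "\<And>s v. norm (act s v) = norm s * norm v"
    and hom: "\<And>s f. s \<noteq> 0 \<Longrightarrow> f \<in> borel_measurable borel \<Longrightarrow>
      ennreal (norm s ^ p) * (\<integral>\<^sup>+v. f (act s v) \<partial>M) = (\<integral>\<^sup>+v. f v \<partial>M)"
    and p: "DIM('s) \<le> p" and null: "emeasure M {0} = 0"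
    and K: "K \<in> sets borel" and B: "B \<in> sets borel"
    and le: "AE v in M. v \<noteq> 0 \<longrightarrow>
      (\<integral>\<^sup>+s. indicator K (act s v) * ennreal (norm s ^ (p - DIM('s))) \<partial>lborel)
        \<le> \<theta> * (\<integral>\<^sup>+s. indicator B (act s v) * ennreal (norm s ^ (p - DIM('s))) \<partial>lborel)"
  shows "emeasure M K \<le> \<theta> * emeasure M B"
proof -
  interpret M: sigma_finite_measure M by fact
  interpret P: pair_sigma_finite "lborel :: 's measure" M ..
  define d where "d = DIM('s)"
  have d: "d > 0" "d \<le> p" using p by (auto simp: d_def)
  have [measurable_cong]: "sets M = sets borel" by (fact sets)
  have act' [measurable]: "(\<lambda>x. act (f x) (g x)) \<in> borel_measurable N"
    if [measurable]: "f \<in> borel_measurable N" "g \<in> borel_measurable N" for N :: "'b measure" and f g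
    using measurable_compose[of "\<lambda>x. (f x, g x)" N borel, OF _ act] by simp
  (* Weighting the directions by the indicator of an annulus makes the constant C finite. *)
  define W where "W = (\<lambda>v::'v. indicator {v. 1 \<le> norm v \<and> norm v \<le> 2} v :: ennreal)"
  have [measurable]: "W \<in> borel_measurable borel" unfolding W_def by measurable
  \<comment> \<open>This is |s|^(-d) times the annulus weight of v, expressed through z = act s v.
    Since |s|^(-d) ds is invariant under dilations, its integral over s is the same for all z other
    than 0.\<close>
  define h where "h z s = ennreal (1 / norm s ^ d) * indicator {s. norm s \<le> norm z \<and> norm z \<le> 2 * norm s} s"
    for z :: 'v and s :: 's
  define h1 where "h1 s = ennreal (1 / norm s ^ d) * indicator {s. norm s \<le> 1 \<and> 1 \<le> 2 * norm s} s"
    for s :: 's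
  define C where "C = (\<integral>\<^sup>+s. h1 s \<partial>lborel)"
  have [measurable]: "h1 \<in> borel_measurable borel" unfolding h1_def by measurable
  have h_meas [measurable]: "(\<lambda>x. h (f x) (g x)) \<in> borel_measurable N"
    if [measurable]: "f \<in> borel_measurable N" "g \<in> borel_measurable N" for N :: "'b measure" and f g
    unfolding h_def by measurable
  have hC: "(\<integral>\<^sup>+s. h z s \<partial>lborel) = C" if "z \<noteq> 0" for z
  proof -
    define c where "c = norm z"
    have c: "c > 0" using that by (simp add: c_def)
    have "(\<integral>\<^sup>+s. h z s \<partial>lborel) = ennreal (c ^ d) * (\<integral>\<^sup>+s. h z (c *\<^sub>R s) \<partial>lborel)"
      unfolding d_def using c by (intro nn_integral_lborel_similarity[symmetric]) auto
    also have "\<dots> = (\<integral>\<^sup>+s. ennreal (c ^ d) * h z (c *\<^sub>R s) \<partial>lborel)"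
      by (rule nn_integral_cmult[symmetric]) measurable
    also have "(\<lambda>s. ennreal (c ^ d) * h z (c *\<^sub>R s)) = h1"
      using c by (auto simp: h_def h1_def c_def[symmetric] indicator_def fun_eq_iff power_mult_distrib ennreal_mult'[symmetric])
    finally show ?thesis by (simp add: C_def)
  qed
  have C_fin: "C < \<infinity>"
  proof -
    have "C \<le> (\<integral>\<^sup>+s. ennreal (2 ^ d) * indicator (cball (0::'s) 1) s \<partial>lborel)"
      unfolding C_def
    proof (rule nn_integral_mono)
      fix s :: 's
      have "1 / norm s ^ d \<le> 2 ^ d" if "1 \<le> 2 * norm s"
      proof -
        have "(1 / 2) ^ d \<le> norm s ^ d" using that by (intro power_mono) auto
        then have "1 / norm s ^ d \<le> 1 / (1 / 2) ^ d" by (intro frac_le) auto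
        then show ?thesis by (simp add: power_divide)
      qed
      then show "h1 s \<le> ennreal (2 ^ d) * indicator (cball 0 1) s"
        by (auto simp: h1_def indicator_def intro: ennreal_leI)
    qed
    also have "\<dots> = ennreal (2 ^ d) * emeasure lborel (cball (0::'s) 1)" by (rule nn_integral_cmult_indicator) simp
    also have "\<dots> < \<infinity>" using emeasure_lborel_cball_finite[of "0::'s" 1] by (simp add: ennreal_mult_less_top)
    finally show ?thesis .
  qed
  have C_pos: "C \<noteq> 0"
  proof -
    obtain b :: 's where b: "b \<in> Basis" using nonempty_Basis by blast
    \<comment> \<open>The ball of radius 1/4 about a point of norm 3/4 lies in the shell 1/2 <= |s|
      <= 1, where \<open>h1\<close> is at least 1.\<close>
    define x where "x = (3 / 4) *\<^sub>R b"
    have nx: "norm x = 3 / 4" using b by (simp add: x_def)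
    have "emeasure lborel (ball x (1 / 4)) = (\<integral>\<^sup>+s. indicator (ball x (1 / 4)) s \<partial>lborel)" by simp
    also have "\<dots> \<le> C"
      unfolding C_def
    proof (rule nn_integral_mono)
      fix s :: 's
      show "indicator (ball x (1 / 4)) s \<le> h1 s"
      proof (cases "s \<in> ball x (1 / 4)")
        case True
        then have n: "norm (x - s) < 1 / 4" by (simp add: dist_norm)
        have "norm s \<le> 1" "1 \<le> 2 * norm s"
          using n nx norm_triangle_ineq2[of s x] norm_triangle_ineq2[of x s] norm_minus_commute[of x s] by linarith+
        moreover from this have "0 < norm s" by linarith
        then have "0 < norm s ^ d" by (rule zero_less_power)
        then have "1 \<le> 1 / norm s ^ d" using power_le_one[of "norm s" d] \<open>norm s \<le> 1\<close> by simp
        then have "1 \<le> ennreal (1 / norm s ^ d)" using ennreal_leI by fastforce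
        ultimately show ?thesis by (simp add: h1_def indicator_def)
      qed simp
    qed
    finally have "emeasure lborel (ball x (1 / 4)) \<le> C" .
    moreover have "emeasure lborel (ball x (1 / 4)) \<noteq> 0"
      by (auto simp: emeasure_ball unit_ball_vol_pos less_imp_neq[symmetric])
    ultimately show ?thesis by auto
  qed
  have polar: "(\<integral>\<^sup>+v. W v * (\<integral>\<^sup>+s. f (act s v) * ennreal (norm s ^ (p - d)) \<partial>lborel) \<partial>M) = C * (\<integral>\<^sup>+v. f v \<partial>M)"
    if f [measurable]: "f \<in> borel_measurable borel" for f :: "'v \<Rightarrow> ennreal"
  proof -
    have "(\<integral>\<^sup>+v. W v * (\<integral>\<^sup>+s. f (act s v) * ennreal (norm s ^ (p - d)) \<partial>lborel) \<partial>M)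
        = (\<integral>\<^sup>+v. (\<integral>\<^sup>+s. W v * (f (act s v) * ennreal (norm s ^ (p - d))) \<partial>lborel) \<partial>M)"
      by (intro nn_integral_cong nn_integral_cmult[symmetric]) measurable
    also have "\<dots> = (\<integral>\<^sup>+s. (\<integral>\<^sup>+v. W v * (f (act s v) * ennreal (norm s ^ (p - d))) \<partial>M) \<partial>lborel)"
      by (rule P.Fubini') measurable
    also have "\<dots> = (\<integral>\<^sup>+s. (\<integral>\<^sup>+z. h z s * f z \<partial>M) \<partial>lborel)"
    proof (rule nn_integral_cong_AE)
      have "(\<integral>\<^sup>+v. W v * (f (act s v) * ennreal (norm s ^ (p - d))) \<partial>M) = (\<integral>\<^sup>+z. h z s * f z \<partial>M)"
        if s: "s \<noteq> 0" for s
      proof -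
        define g where "g z = h z s * f z" for z
        have g [measurable]: "g \<in> borel_measurable borel" unfolding g_def by measurable
        have "ennreal (norm s ^ p) * g (act s v) = W v * (f (act s v) * ennreal (norm s ^ (p - d)))" for v
        proof -
          have "ennreal (norm s ^ p) * ennreal (1 / norm s ^ d) = ennreal (norm s ^ (p - d))"
            using s d(2) by (simp add: ennreal_mult'[symmetric] power_diff)
          moreover have "indicator {s. norm s \<le> norm (act s' v) \<and> norm (act s' v) \<le> 2 * norm s} s = W v" if "s' = s" for s'
            using s that by (simp add: W_def norm_act indicator_def mult.commute)
          ultimately show ?thesis unfolding g_def h_def by (simp add: mult_ac)
        qed
        then have "(\<integral>\<^sup>+v. W v * (f (act s v) * ennreal (norm s ^ (p - d))) \<partial>M) = ennreal (norm s ^ p) * (\<integral>\<^sup>+v. g (act s v) \<partial>M)"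
          by (subst nn_integral_cmult[symmetric]) auto
        then show ?thesis using hom[OF s g] by (simp add: g_def)
      qed
      then show "AE s in lborel. (\<integral>\<^sup>+v. W v * (f (act s v) * ennreal (norm s ^ (p - d))) \<partial>M) = (\<integral>\<^sup>+z. h z s * f z \<partial>M)"
        using AE_lborel_singleton[of "0::'s"] by (auto elim!: eventually_mono)
    qed
    also have "\<dots> = (\<integral>\<^sup>+z. (\<integral>\<^sup>+s. h z s * f z \<partial>lborel) \<partial>M)"
      by (rule P.Fubini'[symmetric]) measurable
    also have "\<dots> = (\<integral>\<^sup>+z. C * f z \<partial>M)"
    proof (rule nn_integral_cong_AE)
      have "AE z in M. z \<noteq> 0" using null by (intro AE_I[of _ _ "{0}"]) (auto simp: sets)
      then show "AE z in M. (\<integral>\<^sup>+s. h z s * f z \<partial>lborel) = C * f z"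
        by (rule AE_mp) (auto intro!: AE_I2 simp: nn_integral_multc hC)
    qed
    also have "\<dots> = C * (\<integral>\<^sup>+v. f v \<partial>M)" by (rule nn_integral_cmult) measurable
    finally show ?thesis .
  qed
  note [measurable] = K B
  have "C * emeasure M K = C * (\<integral>\<^sup>+v. indicator K v \<partial>M)" by (simp add: sets)
  also have "\<dots> = (\<integral>\<^sup>+v. W v * (\<integral>\<^sup>+s. indicator K (act s v) * ennreal (norm s ^ (p - d)) \<partial>lborel) \<partial>M)"
    by (rule polar[symmetric]) measurable
  also have "\<dots> \<le> (\<integral>\<^sup>+v. \<theta> * (W v * (\<integral>\<^sup>+s. indicator B (act s v) * ennreal (norm s ^ (p - d)) \<partial>lborel)) \<partial>M)"
  proof (rule nn_integral_mono_AE)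
    show "AE v in M. W v * (\<integral>\<^sup>+s. indicator K (act s v) * ennreal (norm s ^ (p - d)) \<partial>lborel)
        \<le> \<theta> * (W v * (\<integral>\<^sup>+s. indicator B (act s v) * ennreal (norm s ^ (p - d)) \<partial>lborel))"
      using le
    proof eventually_elim
      case (elim v)
      show ?case
      proof (cases "v = 0")
        case True
        then show ?thesis by (simp add: W_def)
      next
        case False
        then show ?thesis using mult_left_mono[OF elim[rule_format, OF False], of "W v"] by (simp add: d_def mult_ac)
      qed
    qed
  qed
  also have "\<dots> = \<theta> * (\<integral>\<^sup>+v. W v * (\<integral>\<^sup>+s. indicator B (act s v) * ennreal (norm s ^ (p - d)) \<partial>lborel) \<partial>M)"
    by (rule nn_integral_cmult) measurable
  also have "\<dots> = \<theta> * (C * (\<integral>\<^sup>+v. indicator B v \<partial>M))" by (subst polar) auto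
  also have "\<dots> = C * (\<theta> * emeasure M B)" by (simp add: sets mult_ac)
  finally show ?thesis using C_pos C_fin by (simp add: ennreal_mult_le_mult_iff)
qed

subsection \<open>Lebesgue measure and dimension of a generic subspace\<close>

lemma emeasure_affine_real_vimage:
  assumes A: "A \<in> sets borel" and c: "c \<noteq> 0"
  shows "ennreal \<bar>c\<bar> * emeasure lborel ((\<lambda>x. t + c * x) -` A) = emeasure lborel (A :: real set)"
proof -
  note [measurable] = A
  have "emeasure lborel A = (\<integral>\<^sup>+x. indicator A x \<partial>lborel)" by simp
  also have "\<dots> = \<bar>c\<bar> * (\<integral>\<^sup>+x. indicator A (t + c * x) \<partial>lborel)"
    by (rule nn_integral_real_affine) (use c in auto)
  also have "(\<lambda>x. indicator A (t + c * x)) = (indicator ((\<lambda>x. t + c * x) -` A) :: real \<Rightarrow> ennreal)"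
    by (auto simp: indicator_def fun_eq_iff)
  also have "(\<integral>\<^sup>+x. indicator ((\<lambda>x. t + c * x) -` A) x \<partial>lborel) = emeasure lborel ((\<lambda>x. t + c * x) -` A)"
  proof (rule nn_integral_indicator)
    have "(\<lambda>x. t + c * x) -` A \<in> sets borel" by (rule measurable_sets_borel) measurable
    then show "(\<lambda>x. t + c * x) -` A \<in> sets lborel" by simp
  qed
  finally show ?thesis by simp
qed

text \<open>The affine map is restricted to \<open>E\<close> because points of the product space are
  \<open>undefined\<close> off the index set. By uniqueness of the product measure only boxes have
  to be checked, and there the formula factors.\<close>

lemma nn_integral_PiM_lborel_affine:
  fixes E :: "'i set" and g :: "('i \<Rightarrow> real) \<Rightarrow> ennreal"
  assumes E: "finite E" and c: "c \<noteq> 0"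
    and g [measurable]: "g \<in> borel_measurable (\<Pi>\<^sub>M b\<in>E. lborel)"
  shows "ennreal (\<bar>c\<bar> ^ card E) * (\<integral>\<^sup>+f. g (\<lambda>b\<in>E. t b + c * f b) \<partial>(\<Pi>\<^sub>M b\<in>E. lborel))
     = (\<integral>\<^sup>+f. g f \<partial>(\<Pi>\<^sub>M b\<in>E. lborel))"
proof -
  interpret product_sigma_finite "\<lambda>_::'i. lborel :: real measure" ..
  define P where "P = (\<Pi>\<^sub>M b\<in>E. (lborel :: real measure))"
  define A where "A f = (\<lambda>b\<in>E. t b + c * f b)" for f :: "'i \<Rightarrow> real"
  have A_meas [measurable]: "A \<in> measurable P P" unfolding A_def P_def by measurable
  define D where "D = density (distr P P A) (\<lambda>_. ennreal (\<bar>c\<bar> ^ card E))"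
  have "D = P"
    unfolding P_def
  proof (rule PiM_eqI[OF E])
    show "sets D = sets (Pi\<^sub>M E (\<lambda>_. lborel))" by (simp add: D_def P_def)
    fix S :: "'i \<Rightarrow> real set" assume S: "\<And>i. i \<in> E \<Longrightarrow> S i \<in> sets lborel"
    then have PS [measurable]: "Pi\<^sub>E E S \<in> sets P" unfolding P_def by (intro sets_PiM_I_finite E) auto
    have pre: "A -` Pi\<^sub>E E S \<inter> space P = Pi\<^sub>E E (\<lambda>i. (\<lambda>x. t i + c * x) -` S i)"
      by (auto simp: A_def P_def space_PiM PiE_def Pi_def extensional_def)
    have "emeasure D (Pi\<^sub>E E S) = ennreal (\<bar>c\<bar> ^ card E) * emeasure (distr P P A) (Pi\<^sub>E E S)"
      unfolding D_def using PS by (subst emeasure_density) (auto simp: nn_integral_cmult)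
    also have "emeasure (distr P P A) (Pi\<^sub>E E S) = emeasure P (Pi\<^sub>E E (\<lambda>i. (\<lambda>x. t i + c * x) -` S i))"
      by (subst emeasure_distr) (auto simp: pre)
    also have "\<dots> = (\<Prod>i\<in>E. emeasure lborel ((\<lambda>x. t i + c * x) -` S i))"
      unfolding P_def
    proof (rule emeasure_PiM[OF E])
      fix i assume "i \<in> E"
      then have [measurable]: "S i \<in> sets borel" using S by simp
      have "(\<lambda>x. t i + c * x) -` S i \<in> sets borel" by (rule measurable_sets_borel) measurable
      then show "(\<lambda>x. t i + c * x) -` S i \<in> sets lborel" by simp
    qed
    also have "ennreal (\<bar>c\<bar> ^ card E) * \<dots> = (\<Prod>i\<in>E. ennreal \<bar>c\<bar> * emeasure lborel ((\<lambda>x. t i + c * x) -` S i))"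
      by (simp add: prod.distrib ennreal_power)
    also have "\<dots> = (\<Prod>i\<in>E. emeasure lborel (S i))"
      using S c by (intro prod.cong emeasure_affine_real_vimage) auto
    finally show "emeasure D (Pi\<^sub>E E S) = (\<Prod>i\<in>E. emeasure lborel (S i))" .
  qed
  then have "(\<integral>\<^sup>+f. g f \<partial>P) = (\<integral>\<^sup>+f. g f \<partial>D)" by simp
  also have "\<dots> = ennreal (\<bar>c\<bar> ^ card E) * (\<integral>\<^sup>+f. g (A f) \<partial>P)"
    unfolding D_def using g by (simp add: nn_integral_density nn_integral_cmult nn_integral_distr P_def[symmetric])
  finally show ?thesis by (simp add: P_def A_def)
qed

text \<open>Everything is carried over from the coordinates of the basis in the definition. The
  affine formula combines translation invariance along \<open>G\<close> with homogeneity of degree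
  \<open>dim G\<close>. For bounded sets, orthonormality reads the coordinates off as inner
  products, so a ball is contained in a box.\<close>

lemma subspace_lebesgue_properties:
  fixes G :: "'a::euclidean_space set"
  assumes G: "subspace G"
  defines "M \<equiv> subspace_lebesgue G"
  shows sets_subspace_lebesgue: "sets M = sets borel"
    and AE_subspace_lebesgue: "AE v in M. v \<in> G"
    and nn_integral_subspace_lebesgue_affine:
      "\<And>a c f. a \<in> G \<Longrightarrow> c \<noteq> 0 \<Longrightarrow> f \<in> borel_measurable borel \<Longrightarrow>
        ennreal (\<bar>c\<bar> ^ dim G) * (\<integral>\<^sup>+v. f (a + c *\<^sub>R v) \<partial>M) = (\<integral>\<^sup>+v. f v \<partial>M)"
    and emeasure_subspace_lebesgue_bounded: "\<And>A. bounded A \<Longrightarrow> emeasure M A < \<infinity>"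
    and sigma_finite_subspace_lebesgue: "sigma_finite_measure M"
proof -
  interpret product_sigma_finite "\<lambda>_::'a. lborel :: real measure" ..
  define E where "E = (SOME E. orthonormal_basis_of E G)"
  have "orthonormal_basis_of E G"
    unfolding E_def by (rule orthonormal_basis_of_SOME[OF G])
  then have E: "E \<subseteq> G" "pairwise orthogonal E" "\<And>b. b \<in> E \<Longrightarrow> norm b = 1" "span E = G"
    by (auto simp: orthonormal_basis_of_def)
  have "0 \<notin> E" using E(3) by force
  then have ind: "independent E" using E(2) by (intro pairwise_orthogonal_independent)
  then have fin: "finite E" by (rule independent_imp_finite)
  have cardE: "card E = dim G" using ind E(4) by (metis dim_span_eq_card_independent)
  define P where "P = (\<Pi>\<^sub>M b\<in>E. (lborel :: real measure))"
  define T where "T f = (\<Sum>b\<in>E. f b *\<^sub>R b)" for f :: "'a \<Rightarrow> real"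
  have M: "M = distr P borel T"
    by (simp add: M_def subspace_lebesgue_def E_def[symmetric] Let_def P_def T_def[abs_def])
  have comp [measurable]: "(\<lambda>f. f b) \<in> borel_measurable P" if "b \<in> E" for b
    using measurable_component_singleton[OF that, of "\<lambda>_. lborel :: real measure"] by (simp add: P_def)
  have T_meas [measurable]: "T \<in> borel_measurable P"
    unfolding T_def by (intro borel_measurable_sum borel_measurable_scaleR comp) auto
  have Tin: "T f \<in> G" for f
    unfolding T_def E(4)[symmetric] by (intro span_sum span_scale span_base)
  have inner_T: "T f \<bullet> b = f b" if "b \<in> E" for f b
  proof -
    have "T f \<bullet> b = (\<Sum>b'\<in>E. f b' * (b' \<bullet> b))" by (simp add: T_def inner_sum_left)
    also have "\<dots> = (\<Sum>b'\<in>E. if b' = b then f b else 0)"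
    proof (rule sum.cong[OF refl])
      fix b' assume "b' \<in> E"
      then show "f b' * (b' \<bullet> b) = (if b' = b then f b else 0)"
        using E(2,3) that by (auto simp: pairwise_def orthogonal_def dot_square_norm)
    qed
    finally show ?thesis using fin that by simp
  qed
  show sets: "sets M = sets borel" by (simp add: M)
  have "G \<in> sets borel" using closed_subspace[OF G] by simp
  then show "AE v in M. v \<in> G" unfolding M by (subst AE_distr_iff) (auto simp: Tin)
  show "ennreal (\<bar>c\<bar> ^ dim G) * (\<integral>\<^sup>+v. f (a + c *\<^sub>R v) \<partial>M) = (\<integral>\<^sup>+v. f v \<partial>M)"
    if a: "a \<in> G" and c: "c \<noteq> 0" and f [measurable]: "f \<in> borel_measurable borel" for a c f
  proof -
    have "a \<in> range T"
    proof -
      have "a \<in> span E" using a E(4) by simp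
      then obtain r where "a = (\<Sum>b\<in>E. r b *\<^sub>R b)" using fin by (auto simp: span_finite)
      then show ?thesis by (auto simp: T_def)
    qed
    then obtain r where r: "a = T r" by blast
    have T_aff: "T (\<lambda>b\<in>E. r b + c * g b) = a + c *\<^sub>R T g" for g
      by (simp add: T_def r scaleR_sum_right scaleR_left_distrib sum.distrib)
    have "(\<integral>\<^sup>+v. f v \<partial>M) = (\<integral>\<^sup>+g. f (T g) \<partial>P)" unfolding M by (rule nn_integral_distr) auto
    also have "\<dots> = ennreal (\<bar>c\<bar> ^ card E) * (\<integral>\<^sup>+g. f (T (\<lambda>b\<in>E. r b + c * g b)) \<partial>P)"
      unfolding P_def by (rule nn_integral_PiM_lborel_affine[OF fin c, symmetric])
        (simp add: measurable_compose[OF T_meas f] P_def[symmetric])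
    also have "\<dots> = ennreal (\<bar>c\<bar> ^ dim G) * (\<integral>\<^sup>+g. f (a + c *\<^sub>R T g) \<partial>P)" by (simp add: T_aff cardE)
    also have "(\<integral>\<^sup>+g. f (a + c *\<^sub>R T g) \<partial>P) = (\<integral>\<^sup>+v. f (a + c *\<^sub>R v) \<partial>M)"
      unfolding M by (rule nn_integral_distr[symmetric]) auto
    finally show ?thesis by simp
  qed
  show bounded: "emeasure M A < \<infinity>" if A: "bounded A" for A
  proof -
    obtain r where "r > 0" "\<And>x. x \<in> A \<Longrightarrow> norm x \<le> r" using A bounded_pos by blast
    then have r: "r > 0" "A \<subseteq> cball 0 r" by auto
    have "emeasure M A \<le> emeasure M (cball 0 r)" using r(2) by (intro emeasure_mono) (auto simp: sets)
    also have "\<dots> = emeasure P (T -` cball 0 r \<inter> space P)" unfolding M by (rule emeasure_distr) auto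
    also have "\<dots> \<le> emeasure P (Pi\<^sub>E E (\<lambda>_. {- r..r}))"
    proof (rule emeasure_mono)
      show "T -` cball 0 r \<inter> space P \<subseteq> Pi\<^sub>E E (\<lambda>_. {- r..r})"
      proof
        fix f assume f: "f \<in> T -` cball 0 r \<inter> space P"
        have "- r \<le> f b \<and> f b \<le> r" if "b \<in> E" for b
        proof -
          have "\<bar>f b\<bar> \<le> norm (T f)"
            using Cauchy_Schwarz_ineq2[of "T f" b] E(3)[OF that] by (simp add: inner_T[OF that])
          moreover have "norm (T f) \<le> r" using f by simp
          ultimately show ?thesis by linarith
        qed
        moreover have "f \<in> extensional E" using f by (simp add: P_def space_PiM PiE_iff)
        ultimately show "f \<in> Pi\<^sub>E E (\<lambda>_. {- r..r})" by (simp add: PiE_iff)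
      qed
      show "Pi\<^sub>E E (\<lambda>_. {- r..r}) \<in> sets P" unfolding P_def by (intro sets_PiM_I_finite fin) auto
    qed
    also have "\<dots> = (\<Prod>b\<in>E. emeasure lborel {- r..r})" unfolding P_def by (rule emeasure_PiM[OF fin]) auto
    also have "\<dots> = ennreal (2 * r) ^ card E" using r(1) by simp
    also have "\<dots> < \<infinity>" using r(1) by (simp add: ennreal_power)
    finally show ?thesis .
  qed
  show "sigma_finite_measure M"
  proof
    show "\<exists>A. countable A \<and> A \<subseteq> sets M \<and> \<Union> A = space M \<and> (\<forall>a\<in>A. emeasure M a \<noteq> \<infinity>)"
    proof (intro exI conjI ballI)
      show "countable (range (\<lambda>n. ball (0::'a) (real n)))" by simp
      show "\<Union> (range (\<lambda>n. ball (0::'a) (real n))) = space M"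
        by (auto simp: M intro: reals_Archimedean2)
      show "emeasure M a \<noteq> \<infinity>" if a: "a \<in> range (\<lambda>n. ball (0::'a) (real n))" for a
        using bounded[of a] a by (auto simp: less_top)
    qed (auto simp: sets)
  qed
qed

lemma J_linear: "linear (J :: complex ^ 'n \<Rightarrow> complex ^ 'n)"
  by (rule linearI) (simp_all add: J_def vec_eq_iff algebra_simps)

text \<open>A complex basis together with its image under \<open>J\<close> spans the space over the
  reals.\<close>

lemma dim_complex_subspace_le:
  fixes S :: "(complex ^ 'n) set"
  assumes S: "vec.subspace S"
  shows "dim S \<le> 2 * vec.dim S"
proof -
  obtain B where B: "B \<subseteq> S" "vec.independent B" "S \<subseteq> vec.span B" "card B = vec.dim S"
    using vec.basis_exists[of S] by blast
  have finB: "finite B" using B(2) by (rule vec.finiteI_independent)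
  have "S \<subseteq> span (B \<union> J ` B)"
  proof
    fix x assume "x \<in> S"
    then obtain r where x: "x = (\<Sum>b\<in>B. r b *s b)" using B(3) finB by (auto simp: vec.span_finite)
    have "r b *s b \<in> span (B \<union> J ` B)" if "b \<in> B" for b
    proof -
      have "r b *s b = Re (r b) *\<^sub>R b + Im (r b) *\<^sub>R J b"
        by (simp add: J_def vec_eq_iff complex_eq_iff)
      then show ?thesis using that by (simp only:) (intro span_add span_scale span_base; blast)
    qed
    then show "x \<in> span (B \<union> J ` B)" unfolding x by (intro span_sum)
  qed
  then have "dim S \<le> card (B \<union> J ` B)" using finB by (intro dim_le_card) auto
  also have "\<dots> \<le> card B + card (J ` B)" by (rule card_Un_le)
  also have "\<dots> \<le> card B + card B" using card_image_le[OF finB, of J] by simp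
  finally show ?thesis using B(4) by simp
qed

text \<open>Apply the dimension formula to G and J G: their sum has real dimension 2n, and their
  intersection has real dimension at most 2m, so 2 dim G <= 2n + 2m. If dim G were 0, the sum could
  not be the whole space.\<close>

lemma dim_generic_le:
  fixes G :: "(complex ^ 'n) set"
  assumes G: "subspace G" "generic G"
  shows "dim G \<le> CARD('n) + complex_dim G" and "dim G > 0"
proof -
  have JG: "subspace (J ` G)" using J_linear G(1) by (rule linear_subspace_image)
  have J_inj: "inj J"
    by (rule injI) (simp add: J_def vec_eq_iff)
  have dimJ: "dim (J ` G) = dim G" using J_linear J_inj by (intro dim_image_eq) (auto intro: inj_on_subset)
  have JJ: "J (J x) = - x" for x :: "complex ^ 'n" by (simp add: J_def vec_eq_iff)
  define H where "H = G \<inter> J ` G"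
  \<comment> \<open>An element x = J y with y in G satisfies J x = -y, which is again in G. So H is
    stable under multiplication by i, hence a complex subspace.\<close>
  have JH: "J x \<in> H" if x: "x \<in> H" for x
  proof -
    have "x \<in> G" using x by (simp add: H_def)
    moreover obtain y where "y \<in> G" "x = J y" using x by (auto simp: H_def)
    then have "J x \<in> G" using subspace_neg[OF G(1), of y] by (simp add: JJ)
    ultimately show ?thesis by (simp add: H_def)
  qed
  have sH: "subspace H" unfolding H_def using G(1) JG by (rule subspace_inter)
  have "vec.subspace H"
  proof (rule vec.subspaceI)
    show "0 \<in> H" "\<And>x y. x \<in> H \<Longrightarrow> y \<in> H \<Longrightarrow> x + y \<in> H"
      using sH by (auto simp: subspace_0 subspace_add)
    fix c x assume x: "x \<in> H"
    have "c *s x = Re c *\<^sub>R x + Im c *\<^sub>R J x"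
      by (simp add: J_def vec_eq_iff complex_eq_iff)
    then show "c *s x \<in> H" using sH x JH[OF x] by (simp add: subspace_add subspace_scale)
  qed
  then have "dim H \<le> 2 * complex_dim G" unfolding complex_dim_def H_def by (rule dim_complex_subspace_le)
  moreover have sum: "dim {x + y |x y. x \<in> G \<and> y \<in> J ` G} + dim H = 2 * dim G"
    using dim_sums_Int[OF G(1) JG] by (simp add: H_def dimJ)
  moreover have full: "dim {x + y |x y. x \<in> G \<and> y \<in> J ` G} = 2 * CARD('n)"
    using G(2) unfolding generic_def by (simp add: dim_UNIV)
  ultimately show "dim G \<le> CARD('n) + complex_dim G" by linarith
  show "dim G > 0" using sum full by (cases "dim G") auto
qed

subsection \<open>Slices of functions in the Lelong class\<close>

lemma norm_vector_smult: "norm (\<zeta> *s (v :: complex ^ 'n)) = norm \<zeta> * norm v"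
  by (simp add: norm_vec_def norm_mult L2_set_right_distrib)

lemma of_real_smult: "of_real t *s (v :: complex ^ 'n) = t *\<^sub>R v"
  unfolding vec_eq_iff vector_scaleR_component vector_smult_component by (simp add: scaleR_conv_of_real)

text \<open>\<open>h\<close> is the Hermitian product of v and w, whose multiple by zeta has the
  real inner product as its real part. Thus on a circle about 0 in a complex line the squared
  distance to a fixed point is the restriction of a harmonic function.\<close>

lemma norm_smult_add_square:
  fixes v w :: "complex ^ 'n"
  defines "h \<equiv> (\<Sum>i\<in>UNIV. v $ i * cnj (w $ i))"
  shows "(norm (\<zeta> *s v + w))\<^sup>2 = (norm \<zeta>)\<^sup>2 * (norm v)\<^sup>2 + 2 * Re (\<zeta> * h) + (norm w)\<^sup>2"
proof -
  have "(\<zeta> *s v) \<bullet> w = (\<Sum>i\<in>UNIV. Re (\<zeta> * (v $ i * cnj (w $ i))))"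
    unfolding inner_vec_def by (intro sum.cong refl) (simp add: inner_complex_def algebra_simps)
  also have "\<dots> = Re (\<zeta> * h)" by (simp add: h_def sum_distrib_left)
  finally have "(\<zeta> *s v) \<bullet> w = Re (\<zeta> * h)" .
  moreover have "(norm (\<zeta> *s v + w))\<^sup>2 = (norm (\<zeta> *s v))\<^sup>2 + 2 * ((\<zeta> *s v) \<bullet> w) + (norm w)\<^sup>2"
    by (simp add: power2_norm_eq_inner inner_add_left inner_add_right inner_commute)
  ultimately show ?thesis by (simp add: norm_vector_smult power_mult_distrib)
qed

lemma psh_slice: "psh u \<Longrightarrow> subharmonic (\<lambda>\<zeta>. u (a + \<zeta> *s b))"
  by (simp add: psh_def)

lemma lelong_slice_growth:
  assumes "u \<in> lelong"
  obtains C where "\<And>\<zeta>. 1 \<le> norm \<zeta> \<Longrightarrow> u (a + \<zeta> *s b) \<le> ereal (ln (norm \<zeta>) + C)"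
proof -
  have "(SUP z. u z - ereal (log_plus (norm z))) < \<infinity>" using assms by (simp add: lelong_def)
  then obtain C where C: "(SUP z. u z - ereal (log_plus (norm z))) < ereal C" using ereal_dense2 by blast
  have uC: "u z \<le> ereal (log_plus (norm z) + C)" for z
  proof -
    have "u z - ereal (log_plus (norm z)) \<le> (SUP z. u z - ereal (log_plus (norm z)))"
      by (rule SUP_upper) simp
    then have "u z - ereal (log_plus (norm z)) < ereal C" using C by (rule le_less_trans)
    then show ?thesis by (cases "u z") auto
  qed
  \<comment> \<open>The summand 1 makes A >= 1, hence ln (|zeta| A) >= 0 for |zeta| >= 1, so that
    the positive part in \<open>log_plus\<close> is bounded by it as well.\<close>
  define A where "A = norm a + norm b + 1"
  show ?thesis
  proof (rule that[of "ln A + C"])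
    fix \<zeta> :: complex assume \<zeta>: "1 \<le> norm \<zeta>"
    have A: "1 \<le> A" by (simp add: A_def)
    have "norm (a + \<zeta> *s b) \<le> norm a + norm \<zeta> * norm b"
      using norm_triangle_ineq[of a "\<zeta> *s b"] by (simp add: norm_vector_smult)
    also have "\<dots> \<le> norm \<zeta> * norm a + norm \<zeta> * norm b"
      using \<zeta> mult_right_mono[of 1 "norm \<zeta>" "norm a"] by simp
    also have "\<dots> \<le> norm \<zeta> * A" using \<zeta> by (simp add: A_def distrib_left)
    finally have le: "norm (a + \<zeta> *s b) \<le> norm \<zeta> * A" .
    have pos: "norm \<zeta> * A \<ge> 1" using mult_mono[of 1 "norm \<zeta>" 1 A] \<zeta> A by simp
    have "ln (norm (a + \<zeta> *s b)) \<le> ln (norm \<zeta> * A)"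
    proof (cases "a + \<zeta> *s b = 0")
      case True
      then show ?thesis using pos by simp
    next
      case False
      then show ?thesis using le pos by (subst ln_le_cancel_iff) (auto intro: less_le_trans)
    qed
    moreover have "0 \<le> ln (norm \<zeta> * A)" using pos by simp
    moreover have "ln (norm \<zeta> * A) = ln (norm \<zeta>) + ln A" using \<zeta> A by (intro ln_mult_pos) linarith+
    ultimately have "log_plus (norm (a + \<zeta> *s b)) \<le> ln (norm \<zeta>) + ln A" by (simp add: log_plus_def)
    then have "ereal (log_plus (norm (a + \<zeta> *s b)) + C) \<le> ereal (ln (norm \<zeta>) + (ln A + C))" by simp
    with uC show "u (a + \<zeta> *s b) \<le> ereal (ln (norm \<zeta>) + (ln A + C))" by (rule order_trans)
  qed
qed

text \<open>If u were negative on the sphere, its maximum there would lie below some e < 0. Then u +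
  delta |z - a|^2 would be negative on the sphere for a suitable delta > 0 but not at z1, so its
  maximum over the ball would be interior, and the strictly convex term contradicts the mean value
  inequality there.\<close>

lemma psh_boundary_max:
  fixes u :: "complex ^ 'n \<Rightarrow> ereal"
  assumes u: "psh u" and R: "R > 0" and z1: "z1 \<in> cball a R" "0 \<le> u z1"
  shows "\<exists>z0\<in>sphere a R. 0 \<le> u z0"
proof (rule ccontr)
  assume neg: "\<not> ?thesis"
  have usc: "usc u" and fin: "\<And>z. u z < \<infinity>" using u by (auto simp: psh_def)
  \<comment> \<open>Any unit vector will do: the contradiction is obtained on a single complex line
    through the interior maximum.\<close>
  define i :: 'n where "i = undefined"
  define b :: "complex ^ 'n" where "b = axis i 1"
  have nb: "norm b = 1" by (simp add: b_def norm_axis_1)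
  have "a + R *\<^sub>R b \<in> sphere a R" using R nb by (simp add: dist_norm)
  then obtain z0 where z0: "z0 \<in> sphere a R" "\<And>w. w \<in> sphere a R \<Longrightarrow> u w \<le> u z0"
    using usc_diff_attains_max[OF usc compact_sphere, of a R "\<lambda>_. 0"] R by (auto simp: zero_ereal_def[symmetric] Ball_def)
  then have "u z0 < ereal 0" using neg by (auto simp: not_le zero_ereal_def[symmetric])
  then obtain e where e: "u z0 < ereal e" "ereal e < ereal 0" using ereal_dense2 by blast
  \<comment> \<open>On the sphere the perturbation equals -e, just enough to leave u + delta |z -
    a|^2 negative.\<close>
  define \<delta> where "\<delta> = - e / R\<^sup>2"
  have \<delta>: "\<delta> > 0" "\<delta> * R\<^sup>2 = - e" using e(2) R by (auto simp: \<delta>_def divide_pos_pos divide_neg_pos)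
  define q where "q z = - \<delta> * (norm (z - a))\<^sup>2" for z
  have "continuous_on (cball a R) q" unfolding q_def by (intro continuous_intros)
  then obtain z2 where z2: "z2 \<in> cball a R" "\<And>w. w \<in> cball a R \<Longrightarrow> u w - ereal (q w) \<le> u z2 - ereal (q z2)"
    using usc_diff_attains_max[OF usc compact_cball, of a R q] R by (auto simp: Ball_def)
  have "0 \<le> u z1 - ereal (q z1)"
    using z1(2) \<delta>(1) by (cases "u z1") (auto simp: q_def)
  also have "\<dots> \<le> u z2 - ereal (q z2)" using z1(1) by (rule z2(2))
  finally have pos: "0 \<le> u z2 - ereal (q z2)" .
  then obtain x2 where x2: "u z2 = ereal x2" using fin[of z2] by (cases "u z2") auto
  have "dist a z2 \<noteq> R"
  proof
    assume d: "dist a z2 = R"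
    then have "u z2 < ereal e" using z0(2)[of z2] e(1) by (auto intro: le_less_trans)
    moreover have "q z2 = e" using d \<delta>(2) by (simp add: q_def dist_norm norm_minus_commute)
    ultimately show False using pos x2 by simp
  qed
  then have d2: "dist a z2 < R" using z2(1) by simp
  define r where "r = R - dist a z2"
  have r: "r > 0" using d2 by (simp add: r_def)
  define h where "h = (\<Sum>i\<in>UNIV. b $ i * cnj ((z2 - a) $ i))"
  \<comment> \<open>The harmonic function equal to |w - a|^2 on the circle exceeds it by r^2 at the
    centre, so Re G, a majorant on the circle, is delta r^2 below u at z2.\<close>
  define G where "G \<zeta> = of_real (x2 - q z2 - \<delta> * ((norm (z2 - a))\<^sup>2 + r\<^sup>2)) - of_real (2 * \<delta>) * (\<zeta> * h)" for \<zeta>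
  have "u (z2 + 0 *s b) \<le> ereal (Re (G 0))"
  proof (rule subharmonic_le_Re_holomorphic[where u = "\<lambda>\<zeta>. u (z2 + \<zeta> *s b)", OF psh_slice[OF u] r])
    show "G holomorphic_on cball 0 r" unfolding G_def by (intro holomorphic_intros)
    fix \<zeta> :: complex assume "\<zeta> \<in> sphere 0 r"
    then have \<zeta>: "norm \<zeta> = r" by simp
    define w where "w = z2 + \<zeta> *s b"
    have "(norm (w - a))\<^sup>2 = (norm (\<zeta> *s b + (z2 - a)))\<^sup>2" by (simp add: w_def algebra_simps)
    also have "\<dots> = r\<^sup>2 + 2 * Re (\<zeta> * h) + (norm (z2 - a))\<^sup>2"
      unfolding norm_smult_add_square h_def by (simp add: nb \<zeta>)
    finally have nw: "(norm (w - a))\<^sup>2 = r\<^sup>2 + 2 * Re (\<zeta> * h) + (norm (z2 - a))\<^sup>2" .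
    have "Re (G \<zeta>) = x2 - q z2 + q w" unfolding q_def[of w] nw by (simp add: G_def algebra_simps)
    moreover have "w \<in> cball a R"
      using norm_triangle_ineq[of "z2 - a" "\<zeta> *s b"] \<zeta>
      by (simp add: w_def r_def dist_norm norm_minus_commute norm_vector_smult nb algebra_simps)
    then have "u w - ereal (q w) \<le> ereal (x2 - q z2)" using z2(2) x2 by fastforce
    ultimately show "u (z2 + \<zeta> *s b) \<le> ereal (Re (G \<zeta>))" unfolding w_def[symmetric] by (cases "u w") auto
  qed
  moreover have "Re (G 0) = x2 - \<delta> * r\<^sup>2" by (simp add: G_def q_def algebra_simps)
  moreover have "\<delta> * r\<^sup>2 > 0" using \<delta>(1) r by simp
  ultimately show False using x2 by simp
qed

lemma sublevel_borel:
  assumes "usc u"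
  shows "{z. u z \<le> c} \<in> sets borel"
proof -
  have [measurable]: "u \<in> borel_measurable borel" using assms by (rule usc_borel_measurable)
  show ?thesis by measurable
qed

lemma borel_measurable_smult: "(\<lambda>x. fst x *s (snd x :: complex ^ 'n)) \<in> borel_measurable borel"
proof -
  have "(\<lambda>x. fst x *s (snd x :: complex ^ 'n)) = (\<lambda>x. \<chi> i. fst x * snd x $ i)"
    by (simp add: vector_scalar_mult_def)
  also have "\<dots> \<in> borel_measurable borel"
    by (intro borel_measurable_continuous_onI continuous_on_vec_lambda continuous_intros)
  finally show ?thesis .
qed

text \<open>Expanding the squared norm, the constant terms cancel because w is on the sphere; what
  remains is the equation of a disc through 0. For a tangent line c = 0 and the disc is a
  point.\<close>

lemma slice_cball:
  fixes v w :: "complex ^ 'n"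
  assumes v: "v \<noteq> 0" and w: "norm w = R" and R: "R > 0"
  obtains c where "\<And>\<zeta>. \<zeta> *s v + w \<in> cball 0 R \<longleftrightarrow> \<zeta> \<in> cball c (norm c)"
proof -
  define h where "h = (\<Sum>i\<in>UNIV. v $ i * cnj (w $ i))"
  define c where "c = - cnj h / of_real ((norm v)\<^sup>2)"
  have v2: "(norm v)\<^sup>2 > 0" using v by simp
  have "\<zeta> *s v + w \<in> cball 0 R \<longleftrightarrow> \<zeta> \<in> cball c (norm c)" for \<zeta>
  proof -
    have "\<zeta> *s v + w \<in> cball 0 R \<longleftrightarrow> (norm (\<zeta> *s v + w))\<^sup>2 \<le> R\<^sup>2"
      using R by (simp add: abs_le_square_iff[symmetric])
    also have "\<dots> \<longleftrightarrow> (norm \<zeta>)\<^sup>2 * (norm v)\<^sup>2 + 2 * Re (\<zeta> * h) \<le> 0"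
      unfolding norm_smult_add_square h_def[symmetric] by (simp add: w)
    also have "Re (\<zeta> * h) = - (norm v)\<^sup>2 * Re (\<zeta> * cnj c)"
    proof -
      have "h = - of_real ((norm v)\<^sup>2) * cnj c" using v2 by (simp add: c_def)
      then have "\<zeta> * h = of_real (- (norm v)\<^sup>2) * (\<zeta> * cnj c)" by simp
      moreover have "Re (of_real r * w) = r * Re w" for r w by simp
      ultimately show ?thesis by (simp only:)
    qed
    also have "(norm \<zeta>)\<^sup>2 * (norm v)\<^sup>2 + 2 * (- (norm v)\<^sup>2 * Re (\<zeta> * cnj c)) \<le> 0
        \<longleftrightarrow> (norm v)\<^sup>2 * ((norm \<zeta>)\<^sup>2 - 2 * Re (\<zeta> * cnj c)) \<le> 0"
      by (simp add: algebra_simps)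
    also have "\<dots> \<longleftrightarrow> (norm \<zeta>)\<^sup>2 - 2 * Re (\<zeta> * cnj c) \<le> 0"
      using v2 by (auto simp: mult_le_0_iff)
    also have "\<dots> \<longleftrightarrow> (norm (c - \<zeta>))\<^sup>2 \<le> (norm c)\<^sup>2"
      unfolding cmod_power2 by (simp add: power2_eq_square algebra_simps)
    also have "\<dots> \<longleftrightarrow> \<zeta> \<in> cball c (norm c)"
      by (simp add: abs_le_square_iff[symmetric] dist_norm)
    finally show ?thesis .
  qed
  then show ?thesis by (rule that)
qed

text \<open>Multiplication by c maps the unit disc about 1 into the disc about c with 0 on its
  boundary and scales the moment by |c|^(2n + 2).\<close>

lemma nn_integral_power_cball_ge:
  "ennreal (norm c ^ (2 * Suc n) * (pi * fact (2 * n + 1) / (fact (n + 1))\<^sup>2))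
     \<le> (\<integral>\<^sup>+z\<in>cball (c::complex) (norm c). ennreal (norm z ^ (2 * n)) \<partial>lborel)"
proof (cases "c = 0")
  case False
  define f where "f z = ennreal (norm z ^ (2 * n)) * indicator (cball c (norm c)) z" for z :: complex
  have [measurable]: "cball c (norm c) \<in> sets borel" "ball (1::complex) 1 \<in> sets borel" by simp_all
  have [measurable]: "f \<in> borel_measurable borel" unfolding f_def by measurable
  have "ennreal (norm c ^ (2 * Suc n) * (pi * fact (2 * n + 1) / (fact (n + 1))\<^sup>2))
      = ennreal (norm c ^ 2) * (ennreal (norm c ^ (2 * n)) * (\<integral>\<^sup>+z\<in>ball (1::complex) 1. ennreal (norm z ^ (2 * n)) \<partial>lborel))"
    unfolding nn_integral_norm_power_ball
    by (simp add: ennreal_mult'[symmetric] power2_eq_square mult_ac)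
  also have "\<dots> = ennreal (norm c ^ 2) * (\<integral>\<^sup>+z. ennreal (norm c ^ (2 * n)) * (ennreal (norm z ^ (2 * n)) * indicator (ball (1::complex) 1) z) \<partial>lborel)"
    by (subst nn_integral_cmult) auto
  also have "\<dots> \<le> ennreal (norm c ^ 2) * (\<integral>\<^sup>+z. f (c * z) \<partial>lborel)"
  proof (intro mult_left_mono nn_integral_mono)
    fix z :: complex
    show "ennreal (norm c ^ (2 * n)) * (ennreal (norm z ^ (2 * n)) * indicator (ball 1 1) z) \<le> f (c * z)"
    proof (cases "z \<in> ball 1 1")
      case True
      have "norm (c - c * z) = norm c * norm (1 - z)" by (simp add: norm_mult[symmetric] algebra_simps)
      also have "\<dots> \<le> norm c * 1" using True by (intro mult_left_mono) (auto simp: dist_norm)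
      finally have "c * z \<in> cball c (norm c)" by (simp add: dist_norm)
      then show ?thesis using True
        by (simp add: f_def norm_mult power_mult_distrib ennreal_mult'[symmetric])
    qed simp
  qed auto
  also have "\<dots> = (\<integral>\<^sup>+z. f z \<partial>lborel)"
  proof -
    have "ennreal (norm c ^ DIM(complex)) * (\<integral>\<^sup>+z. f (c * z) \<partial>lborel) = (\<integral>\<^sup>+z. f z \<partial>lborel)"
      using False by (intro nn_integral_lborel_similarity)
        (auto simp: norm_mult intro: bounded_linear.linear[OF bounded_linear_mult_right])
    then show ?thesis by simp
  qed
  finally show ?thesis by (simp add: f_def)
qed simp

section \<open>Volume of sublevel sets in complex and in generic balls\<close>

lemma sublevel_volume_complex_ball:
  fixes a :: "complex ^ 'n" and u :: "complex ^ 'n \<Rightarrow> ereal"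
  assumes R: "R > 0" and u: "u \<in> lelong" and max: "has_max_on u (cball a R) 0" and s: "s > 0"
  shows "emeasure lborel {z \<in> cball a R. u z \<le> ereal (- s)}
    \<le> ennreal (4 ^ CARD('n) * (fact CARD('n))\<^sup>2 / fact (2 * CARD('n) - 1) * exp (- 2 * s)) * emeasure lborel (cball a R)"
proof -
  have psh: "psh u" using u by (simp add: lelong_def)
  then have usc: "usc u" by (simp add: psh_def)
  obtain z0 where z0: "z0 \<in> sphere a R" "0 \<le> u z0"
    using psh_boundary_max[OF psh R] max unfolding has_max_on_def by force
  obtain n where n: "CARD('n) = Suc n" using zero_less_card_finite[where 'a = 'n] gr0_implies_Suc by blast
  define \<kappa> :: real where "\<kappa> = pi * fact (2 * n + 1) / (fact (n + 1))\<^sup>2"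
  have \<kappa>: "\<kappa> > 0" by (simp add: \<kappa>_def)
  \<comment> \<open>Here \<open>n\<close> is the complex dimension minus 1. Both the bound for the
    sublevel set and the moment of the disc are multiples of |c|^(2n + 2), so their quotient is the
    same for all slices.\<close>
  define \<theta> :: real where "\<theta> = 4 ^ Suc n * pi * exp (- 2 * s) / \<kappa>"
  have \<theta>_eq: "\<theta> = 4 ^ CARD('n) * (fact CARD('n))\<^sup>2 / fact (2 * CARD('n) - 1) * exp (- 2 * s)"
    unfolding \<theta>_def \<kappa>_def n by simp
  define K where "K = {v. z0 + v \<in> cball a R \<and> u (z0 + v) \<le> ereal (- s)}"
  define B where "B = {v. z0 + v \<in> cball a R}"
  have [measurable]: "{z. u z \<le> ereal (- s)} \<in> sets borel" using usc by (rule sublevel_borel)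
  have Sb [measurable]: "{z \<in> cball a R. u z \<le> ereal (- s)} \<in> sets borel"
    using sublevel_borel[OF usc, of "ereal (- s)"] by (auto intro: sets.Int simp: Collect_conj_eq)
  have Bb [measurable]: "cball a R \<in> sets borel" by simp
  have shift: "emeasure lborel {v. z0 + v \<in> A} = emeasure lborel A" if "A \<in> sets borel" for A
  proof -
    have "emeasure (distr lborel borel ((+) z0)) A = emeasure lborel ((+) z0 -` A)"
      using that by (subst emeasure_distr) auto
    then show ?thesis by (simp add: lborel_distr_plus vimage_def)
  qed
  have Kb: "K \<in> sets borel"
    using measurable_sets_borel[of "(+) z0", OF _ Sb] by (simp add: K_def vimage_def)
  have Bb': "B \<in> sets borel"
    using measurable_sets_borel[of "(+) z0", OF _ Bb] by (simp add: B_def vimage_def)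
  have "emeasure lborel K \<le> ennreal \<theta> * emeasure lborel B"
  proof (rule slice_comparison[where act = "\<lambda>\<zeta> v. \<zeta> *s v" and p = "DIM(complex ^ 'n)"])
    show "ennreal (norm \<zeta> ^ DIM(complex ^ 'n)) * (\<integral>\<^sup>+v. f (\<zeta> *s v) \<partial>lborel) = (\<integral>\<^sup>+v. f v \<partial>lborel)"
      if "\<zeta> \<noteq> 0" "f \<in> borel_measurable borel" for \<zeta> and f :: "complex ^ 'n \<Rightarrow> ennreal"
      using that by (intro nn_integral_lborel_similarity linearI)
        (auto simp: norm_vector_smult vec_eq_iff algebra_simps)
    show "AE v in lborel. v \<noteq> 0 \<longrightarrow>
       (\<integral>\<^sup>+\<zeta>. indicator K (\<zeta> *s v) * ennreal (norm \<zeta> ^ (DIM(complex ^ 'n) - DIM(complex))) \<partial>lborel)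
       \<le> ennreal \<theta> * (\<integral>\<^sup>+\<zeta>. indicator B (\<zeta> *s v) * ennreal (norm \<zeta> ^ (DIM(complex ^ 'n) - DIM(complex))) \<partial>lborel)"
    proof (intro AE_I2 impI)
      fix v :: "complex ^ 'n" assume v: "v \<noteq> 0"
      have ex: "DIM(complex ^ 'n) - DIM(complex) = 2 * n" by (simp add: n)
      have "norm (z0 - a) = R" using z0(1) by (simp add: dist_norm norm_minus_commute)
      then obtain c where "\<And>\<zeta>. \<zeta> *s v + (z0 - a) \<in> cball 0 R \<longleftrightarrow> \<zeta> \<in> cball c (norm c)"
        using slice_cball[OF v _ R] by blast
      then have c: "\<zeta> *s v \<in> B \<longleftrightarrow> \<zeta> \<in> cball c (norm c)" for \<zeta>
        by (simp add: B_def dist_norm norm_minus_commute algebra_simps)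
      define S where "S = {\<zeta>. \<zeta> *s v \<in> K}"
      have "(\<lambda>\<zeta>. \<zeta> *s v) \<in> borel_measurable borel"
        using measurable_compose[OF _ borel_measurable_smult, of "\<lambda>\<zeta>. (\<zeta>, v)" borel] by simp
      then have Sb': "S \<in> sets borel"
        using measurable_sets_borel[OF _ Kb, of "\<lambda>\<zeta>. \<zeta> *s v"] by (simp add: S_def vimage_def)
      have S_disc: "S \<subseteq> cball c (norm c)" using c by (auto simp: S_def K_def B_def)
      obtain C where C: "\<And>\<zeta>. 1 \<le> norm \<zeta> \<Longrightarrow> u (z0 + \<zeta> *s v) \<le> ereal (ln (norm \<zeta>) + C)"
        using lelong_slice_growth[OF u] by blast
      have area: "emeasure lborel S \<le> ennreal (4 * pi * (norm c)\<^sup>2 * exp (- 2 * s))"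
        by (rule sublevel_area_disc[where u = "\<lambda>\<zeta>. u (z0 + \<zeta> *s v)", OF psh_slice[OF psh] C _ s Sb' S_disc])
          (use z0(2) in \<open>auto simp: S_def K_def\<close>)
      have "(\<integral>\<^sup>+\<zeta>. indicator K (\<zeta> *s v) * ennreal (norm \<zeta> ^ (2 * n)) \<partial>lborel)
          \<le> (\<integral>\<^sup>+\<zeta>. ennreal ((2 * norm c) ^ (2 * n)) * indicator S \<zeta> \<partial>lborel)"
      proof (rule nn_integral_mono)
        fix \<zeta> :: complex
        have "norm \<zeta> ^ (2 * n) \<le> (2 * norm c) ^ (2 * n)" if "\<zeta> \<in> S"
        proof (rule power_mono)
          have "dist c \<zeta> \<le> norm c" using that S_disc by auto
          then show "norm \<zeta> \<le> 2 * norm c" using norm_triangle_ineq2[of \<zeta> c] by (simp add: dist_norm norm_minus_commute)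
        qed simp
        then show "indicator K (\<zeta> *s v) * ennreal (norm \<zeta> ^ (2 * n)) \<le> ennreal ((2 * norm c) ^ (2 * n)) * indicator S \<zeta>"
          by (auto simp: S_def indicator_def intro: ennreal_leI)
      qed
      also have "\<dots> = ennreal ((2 * norm c) ^ (2 * n)) * emeasure lborel S"
        using Sb' by (intro nn_integral_cmult_indicator) simp
      also have "\<dots> \<le> ennreal ((2 * norm c) ^ (2 * n)) * ennreal (4 * pi * (norm c)\<^sup>2 * exp (- 2 * s))"
        using area by (rule mult_left_mono) simp
      also have "\<dots> = ennreal ((2 * norm c) ^ (2 * n) * (4 * pi * (norm c)\<^sup>2 * exp (- 2 * s)))"
        by (rule ennreal_mult'[symmetric]) simp
      also have "(2 * norm c) ^ (2 * n) * (4 * pi * (norm c)\<^sup>2 * exp (- 2 * s)) = \<theta> * (norm c ^ (2 * Suc n) * \<kappa>)"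
        using \<kappa> by (simp add: \<theta>_def power_mult power_mult_distrib power2_eq_square)
      also have "ennreal (\<theta> * (norm c ^ (2 * Suc n) * \<kappa>)) = ennreal \<theta> * ennreal (norm c ^ (2 * Suc n) * \<kappa>)"
        using \<kappa> by (intro ennreal_mult') (simp add: \<theta>_def)
      also have "\<dots> \<le> ennreal \<theta> * (\<integral>\<^sup>+z\<in>cball c (norm c). ennreal (norm z ^ (2 * n)) \<partial>lborel)"
        unfolding \<kappa>_def by (intro mult_left_mono nn_integral_power_cball_ge) simp
      also have "(\<integral>\<^sup>+z\<in>cball c (norm c). ennreal (norm z ^ (2 * n)) \<partial>lborel)
          = (\<integral>\<^sup>+\<zeta>. indicator B (\<zeta> *s v) * ennreal (norm \<zeta> ^ (2 * n)) \<partial>lborel)"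
        by (intro nn_integral_cong) (auto simp: c indicator_def)
      finally show "(\<integral>\<^sup>+\<zeta>. indicator K (\<zeta> *s v) * ennreal (norm \<zeta> ^ (DIM(complex ^ 'n) - DIM(complex))) \<partial>lborel)
       \<le> ennreal \<theta> * (\<integral>\<^sup>+\<zeta>. indicator B (\<zeta> *s v) * ennreal (norm \<zeta> ^ (DIM(complex ^ 'n) - DIM(complex))) \<partial>lborel)"
        unfolding ex .
    qed
  qed (auto simp: Kb Bb' borel_measurable_smult norm_vector_smult n sigma_finite_lborel)
  then show ?thesis
    unfolding \<theta>_eq K_def B_def using shift[OF Sb] shift[OF Bb] by simp
qed

lemma half_line_comparison:
  fixes a z0 v :: "complex ^ 'n" and u :: "complex ^ 'n \<Rightarrow> ereal"
  assumes u: "u \<in> lelong" and z0: "z0 \<in> cball a R" "0 \<le> u z0" and s: "s > 0" and v: "v \<noteq> 0"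
  shows "(\<integral>\<^sup>+t\<in>{0<..}. indicator {z \<in> cball a R. u z \<le> ereal (- s)} (z0 + t *\<^sub>R v) * ennreal (\<bar>t\<bar> ^ k) \<partial>lborel)
     \<le> ennreal (8 * real (Suc k) * exp (- s)) *
        (\<integral>\<^sup>+t\<in>{0<..}. indicator (cball a R) (z0 + t *\<^sub>R v) * ennreal (\<bar>t\<bar> ^ k) \<partial>lborel)"
proof -
  have psh: "psh u" using u by (simp add: lelong_def)
  then have usc: "usc u" by (simp add: psh_def)
  define T where "T = {t \<in> {0..}. z0 + t *\<^sub>R v \<in> cball a R}"
  define S where "S = {t. 0 < t \<and> z0 + t *\<^sub>R v \<in> {z \<in> cball a R. u z \<le> ereal (- s)}}"
  have T0: "0 \<in> T" using z0(1) by (simp add: T_def)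
  have bound: "t \<le> (2 * R) / norm v" if "t \<in> T" for t
  proof -
    have "norm (t *\<^sub>R v) \<le> norm (z0 + t *\<^sub>R v - a) + norm (z0 - a)"
      using norm_triangle_ineq4[of "z0 + t *\<^sub>R v - a" "z0 - a"] by simp
    also have "\<dots> \<le> R + R" using that z0(1) by (intro add_mono) (auto simp: T_def dist_norm norm_minus_commute)
    finally show ?thesis using that v by (simp add: T_def pos_le_divide_eq)
  qed
  have "closed T"
    unfolding T_def mem_cball by (intro continuous_on_closed_Collect_le continuous_intros closed_atLeast)
  moreover have bdd: "bdd_above T" using bound by (rule bdd_aboveI)
  ultimately have Sup_T: "Sup T \<in> T" using T0 by (intro closed_contains_Sup) auto
  \<comment> \<open>By compactness and convexity the half-line meets the ball exactly in 0 <= t <=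
    l. The value l = 0 can occur, when the half-line leaves the ball at once.\<close>
  define l where "l = Sup T"
  have lT: "l \<in> T" "l \<ge> 0" using Sup_T by (auto simp: l_def T_def)
  have T_l: "t \<le> l" if "t \<in> T" for t unfolding l_def using that bdd by (rule cSup_upper)
  have seg: "z0 + t *\<^sub>R v \<in> cball a R" if "0 \<le> t" "t \<le> l" for t
  proof (cases "l = 0")
    case True
    then show ?thesis using that z0(1) by simp
  next
    case False
    then have l: "l > 0" using lT(2) by simp
    have "(1 - t / l) *\<^sub>R z0 + (t / l) *\<^sub>R (z0 + l *\<^sub>R v) \<in> cball a R"
      using lT(1) z0(1) that l by (intro convexD_alt[OF convex_cball]) (auto simp: T_def)
    moreover have "(1 - t / l) *\<^sub>R z0 + (t / l) *\<^sub>R (z0 + l *\<^sub>R v) = z0 + t *\<^sub>R v"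
      using l by (simp add: algebra_simps)
    ultimately show ?thesis by simp
  qed
  have line: "(\<lambda>t. z0 + t *\<^sub>R v) \<in> borel_measurable borel" by measurable
  have Sb0: "{z \<in> cball a R. u z \<le> ereal (- s)} \<in> sets borel"
    using sublevel_borel[OF usc, of "ereal (- s)"] by (auto intro: sets.Int simp: Collect_conj_eq)
  have "{0<..} \<inter> (\<lambda>t. z0 + t *\<^sub>R v) -` {z \<in> cball a R. u z \<le> ereal (- s)} \<in> sets borel"
    using measurable_sets_borel[OF line Sb0] by (intro sets.Int) auto
  also have "{0<..} \<inter> (\<lambda>t. z0 + t *\<^sub>R v) -` {z \<in> cball a R. u z \<le> ereal (- s)} = S"
    by (auto simp: S_def)
  finally have Sb: "S \<in> sets borel" .
  have Sl: "S \<subseteq> {0..l}" using T_l by (auto simp: S_def T_def)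
  obtain C where C: "\<And>\<zeta>. 1 \<le> norm \<zeta> \<Longrightarrow> u (z0 + \<zeta> *s v) \<le> ereal (ln (norm \<zeta>) + C)"
    using lelong_slice_growth[OF u] by blast
  have len: "emeasure lborel S \<le> ennreal (8 * l * exp (- s))"
    by (rule sublevel_length_segment[where u = "\<lambda>\<zeta>. u (z0 + \<zeta> *s v)", OF psh_slice[OF psh] C _ s lT(2) Sb Sl])
      (use z0(2) in \<open>auto simp: S_def of_real_smult\<close>)
  have "(\<integral>\<^sup>+t\<in>{0<..}. indicator {z \<in> cball a R. u z \<le> ereal (- s)} (z0 + t *\<^sub>R v) * ennreal (\<bar>t\<bar> ^ k) \<partial>lborel)
      \<le> (\<integral>\<^sup>+t. ennreal (l ^ k) * indicator S t \<partial>lborel)"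
  proof (rule nn_integral_mono)
    fix t :: real
    have "\<bar>t\<bar> ^ k \<le> l ^ k" if "t \<in> S" using that Sl by (intro power_mono) auto
    then show "indicator {z \<in> cball a R. u z \<le> ereal (- s)} (z0 + t *\<^sub>R v) * ennreal (\<bar>t\<bar> ^ k) * indicator {0<..} t
        \<le> ennreal (l ^ k) * indicator S t"
      by (auto simp: S_def indicator_def intro: ennreal_leI)
  qed
  also have "\<dots> = ennreal (l ^ k) * emeasure lborel S" using Sb by (intro nn_integral_cmult_indicator) simp
  also have "\<dots> \<le> ennreal (l ^ k) * ennreal (8 * l * exp (- s))" using len by (rule mult_left_mono) simp
  also have "\<dots> = ennreal (l ^ k * (8 * l * exp (- s)))" using lT(2) by (intro ennreal_mult'[symmetric]) simp
  also have "l ^ k * (8 * l * exp (- s)) = (8 * real (Suc k) * exp (- s)) * (l ^ Suc k / real (Suc k) - 0 ^ Suc k / real (Suc k))"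
    by (simp add: field_simps)
  also have "ennreal \<dots> = ennreal (8 * real (Suc k) * exp (- s)) * ennreal (l ^ Suc k / real (Suc k) - 0 ^ Suc k / real (Suc k))"
    by (rule ennreal_mult') simp
  also have "ennreal (l ^ Suc k / real (Suc k) - 0 ^ Suc k / real (Suc k)) = (\<integral>\<^sup>+t. ennreal (t ^ k) * indicator {0<..<l} t \<partial>lborel)"
  proof (rule nn_integral_has_integral_Ioo[symmetric])
    fix x :: real
    show "((\<lambda>x. x ^ Suc k / real (Suc k)) has_real_derivative x ^ k) (at x)"
      by (rule DERIV_cong[OF DERIV_cdivide[OF DERIV_pow[of "Suc k" x]]]) simp
  qed (use lT(2) in auto)
  also have "ennreal (8 * real (Suc k) * exp (- s)) * (\<integral>\<^sup>+t. ennreal (t ^ k) * indicator {0<..<l} t \<partial>lborel)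
      \<le> ennreal (8 * real (Suc k) * exp (- s)) *
        (\<integral>\<^sup>+t\<in>{0<..}. indicator (cball a R) (z0 + t *\<^sub>R v) * ennreal (\<bar>t\<bar> ^ k) \<partial>lborel)"
    using seg by (intro mult_left_mono nn_integral_mono) (auto simp: indicator_def)
  finally show ?thesis .
qed

lemma nn_integral_lborel_split_0:
  fixes f :: "real \<Rightarrow> ennreal"
  assumes [measurable]: "f \<in> borel_measurable borel"
  shows "(\<integral>\<^sup>+t. f t \<partial>lborel) = (\<integral>\<^sup>+t\<in>{0<..}. f t \<partial>lborel) + (\<integral>\<^sup>+t\<in>{0<..}. f (- t) \<partial>lborel)"
proof -
  have "(\<integral>\<^sup>+t. f t \<partial>lborel) = (\<integral>\<^sup>+t. f t * indicator {0<..} t + f t * indicator {..<0} t \<partial>lborel)"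
    using AE_lborel_singleton[of "0::real"]
    by (intro nn_integral_cong_AE) (auto elim!: eventually_mono simp: indicator_def)
  also have "\<dots> = (\<integral>\<^sup>+t\<in>{0<..}. f t \<partial>lborel) + (\<integral>\<^sup>+t\<in>{..<0}. f t \<partial>lborel)"
    by (rule nn_integral_add) measurable
  also have "(\<integral>\<^sup>+t\<in>{..<0}. f t \<partial>lborel) = (\<integral>\<^sup>+t\<in>{0<..}. f (- t) \<partial>lborel)"
    by (subst nn_integral_real_affine[of _ "-1" 0]) (auto intro!: nn_integral_cong simp: indicator_def)
  finally show ?thesis .
qed

lemma sublevel_volume_generic_ball:
  fixes G :: "(complex ^ 'n) set" and u :: "complex ^ 'n \<Rightarrow> ereal"
  assumes G: "subspace G" "generic G" and a: "a \<in> G"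
    and u: "u \<in> lelong" and max: "has_max_on u (cball a R \<inter> G) 0" and s: "s > 0"
  shows "emeasure (subspace_lebesgue G) {z \<in> cball a R \<inter> G. u z \<le> ereal (- s)}
    \<le> ennreal (8 * real (CARD('n) + complex_dim G) * exp (- s)) * emeasure (subspace_lebesgue G) (cball a R \<inter> G)"
proof -
  define M where "M = subspace_lebesgue G"
  note props = subspace_lebesgue_properties[OF G(1), folded M_def]
  have sets: "sets M = sets borel" by (fact props(1))
  have [measurable_cong]: "sets M = sets borel" by (fact sets)
  have psh: "psh u" using u by (simp add: lelong_def)
  then have usc: "usc u" by (simp add: psh_def)
  obtain z0 where z0: "z0 \<in> cball a R" "z0 \<in> G" "0 \<le> u z0"
    using max unfolding has_max_on_def by force
  obtain k where k: "dim G = Suc k" using dim_generic_le(2)[OF G] gr0_implies_Suc by blast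
  have km: "Suc k \<le> CARD('n) + complex_dim G" using dim_generic_le(1)[OF G] k by simp
  define \<theta> where "\<theta> = 8 * real (Suc k) * exp (- s)"
  define Q where "Q = {z \<in> cball a R. u z \<le> ereal (- s)}"
  define K where "K = {v. z0 + v \<in> Q \<inter> G}"
  define B where "B = {v. z0 + v \<in> cball a R \<inter> G}"
  have Gb [measurable]: "G \<in> sets borel" using closed_subspace[OF G(1)] by simp
  have Qb: "Q \<in> sets borel"
    unfolding Q_def using sublevel_borel[OF usc, of "ereal (- s)"] by (auto intro: sets.Int simp: Collect_conj_eq)
  have QG: "Q \<inter> G \<in> sets borel" and BG: "cball a R \<inter> G \<in> sets borel" using Qb Gb by auto
  have Kb [measurable]: "K \<in> sets borel"
    using measurable_sets_borel[of "(+) z0", OF _ QG] by (simp add: K_def vimage_def)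
  have Bb [measurable]: "B \<in> sets borel"
    using measurable_sets_borel[of "(+) z0", OF _ BG] by (simp add: B_def vimage_def)
  have shift: "emeasure M {v. z0 + v \<in> A} = emeasure M A" if A [measurable]: "A \<in> sets borel" for A
  proof -
    have "{v. z0 + v \<in> A} \<in> sets borel"
      using measurable_sets_borel[of "(+) z0", OF _ A] by (simp add: vimage_def)
    then have "emeasure M {v. z0 + v \<in> A} = (\<integral>\<^sup>+v. indicator {v. z0 + v \<in> A} v \<partial>M)"
      by (simp add: sets)
    also have "\<dots> = (\<integral>\<^sup>+v. indicator A (z0 + 1 *\<^sub>R v) \<partial>M)"
      by (intro nn_integral_cong) (simp add: indicator_def)
    also have "\<dots> = (\<integral>\<^sup>+v. indicator A v \<partial>M)"
      using props(3)[OF z0(2), of 1 "indicator A"] by simp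
    finally show ?thesis by (simp add: sets)
  qed
  have "emeasure M K \<le> ennreal \<theta> * emeasure M B"
  proof (rule slice_comparison[where act = "\<lambda>(t::real) v. t *\<^sub>R v" and p = "dim G"])
    show hom: "ennreal (norm t ^ dim G) * (\<integral>\<^sup>+v. f (t *\<^sub>R v) \<partial>M) = (\<integral>\<^sup>+v. f v \<partial>M)"
      if "t \<noteq> 0" "f \<in> borel_measurable borel" for t :: real and f
      using props(3)[OF subspace_0[OF G(1)] that] by simp
    show "(\<lambda>x. fst x *\<^sub>R snd x :: complex ^ 'n) \<in> borel_measurable borel"
      by (intro borel_measurable_continuous_onI continuous_intros)
    \<comment> \<open>Doubling fixes the set {0} but multiplies measures by 2^(dim G), which is not
      1; since the measure of {0} is finite, it must vanish.\<close>
    show "emeasure M {0} = 0"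
    proof -
      have "ennreal (norm (2::real) ^ dim G) * (\<integral>\<^sup>+v. indicator {0} (2 *\<^sub>R v) \<partial>M) = (\<integral>\<^sup>+v. indicator {0} v \<partial>M)"
        by (rule hom) auto
      moreover have "(\<lambda>v. indicator {0} (2 *\<^sub>R v)) = (indicator {0} :: complex ^ 'n \<Rightarrow> ennreal)"
        by (auto simp: indicator_def fun_eq_iff)
      ultimately have eq: "ennreal (2 ^ dim G) * emeasure M {0} = emeasure M {0}" by (simp add: sets)
      obtain x where x: "emeasure M {0} = ennreal x" "x \<ge> 0"
        using props(4)[of "{0}"] by (cases "emeasure M {0}") auto
      have "2 ^ dim G * x = x" using eq x by (simp add: ennreal_mult'[symmetric])
      moreover have "(2::real) ^ dim G \<noteq> 1" using k power_eq_1_iff[of "2::real" "dim G"] one_less_power[of "2::real" "dim G"] by simp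
      ultimately show ?thesis using x by simp
    qed
    show "AE v in M. v \<noteq> 0 \<longrightarrow>
       (\<integral>\<^sup>+t. indicator K (t *\<^sub>R v) * ennreal (norm t ^ (dim G - DIM(real))) \<partial>lborel)
       \<le> ennreal \<theta> * (\<integral>\<^sup>+t. indicator B (t *\<^sub>R v) * ennreal (norm t ^ (dim G - DIM(real))) \<partial>lborel)"
      using props(2)
    proof (eventually_elim, intro impI)
      fix v assume v: "v \<in> G" "v \<noteq> 0"
      have ex: "dim G - DIM(real) = k" by (simp add: k)
      \<comment> \<open>Almost every direction lies in G, and then so does the whole line through
        z0; hence the intersection with G disappears from the slice integrals.\<close>
      have inG: "z0 + t *\<^sub>R v \<in> G" for t using G(1) z0(2) v(1) by (simp add: subspace_add subspace_scale)
      define fK where "fK t = indicator Q (z0 + t *\<^sub>R v) * ennreal (\<bar>t\<bar> ^ k)" for t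
      define fB where "fB t = indicator (cball a R) (z0 + t *\<^sub>R v) * ennreal (\<bar>t\<bar> ^ k)" for t
      have [measurable]: "cball a R \<in> sets borel" by simp
      note [measurable] = Qb
      have [measurable]: "fK \<in> borel_measurable borel" "fB \<in> borel_measurable borel"
        unfolding fK_def fB_def by measurable
      have "(\<integral>\<^sup>+t. indicator K (t *\<^sub>R v) * ennreal (norm t ^ k) \<partial>lborel) = (\<integral>\<^sup>+t. fK t \<partial>lborel)"
        by (intro nn_integral_cong) (auto simp: fK_def K_def inG indicator_def)
      also have "\<dots> = (\<integral>\<^sup>+t\<in>{0<..}. fK t \<partial>lborel) + (\<integral>\<^sup>+t\<in>{0<..}. fK (- t) \<partial>lborel)"
        by (rule nn_integral_lborel_split_0) measurable
      also have "\<dots> \<le> ennreal \<theta> * (\<integral>\<^sup>+t\<in>{0<..}. fB t \<partial>lborel) + ennreal \<theta> * (\<integral>\<^sup>+t\<in>{0<..}. fB (- t) \<partial>lborel)"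
        using half_line_comparison[OF u z0(1,3) s v(2), of k] half_line_comparison[OF u z0(1,3) s, of "- v" k] v(2)
        unfolding fK_def fB_def Q_def \<theta>_def by (intro add_mono) auto
      also have "\<dots> = ennreal \<theta> * (\<integral>\<^sup>+t. fB t \<partial>lborel)"
        unfolding distrib_left[symmetric] by (subst nn_integral_lborel_split_0[of fB]) auto
      also have "(\<integral>\<^sup>+t. fB t \<partial>lborel) = (\<integral>\<^sup>+t. indicator B (t *\<^sub>R v) * ennreal (norm t ^ k) \<partial>lborel)"
        by (intro nn_integral_cong) (auto simp: fB_def B_def inG indicator_def)
      finally show "(\<integral>\<^sup>+t. indicator K (t *\<^sub>R v) * ennreal (norm t ^ (dim G - DIM(real))) \<partial>lborel)
       \<le> ennreal \<theta> * (\<integral>\<^sup>+t. indicator B (t *\<^sub>R v) * ennreal (norm t ^ (dim G - DIM(real))) \<partial>lborel)"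
        unfolding ex .
    qed
  qed (auto simp: Kb Bb sets props(5) k)
  also have "\<dots> \<le> ennreal (8 * real (CARD('n) + complex_dim G) * exp (- s)) * emeasure M B"
    unfolding \<theta>_def using km by (intro mult_right_mono ennreal_leI) auto
  finally have "emeasure M (Q \<inter> G) \<le> ennreal (8 * real (CARD('n) + complex_dim G) * exp (- s)) * emeasure M (cball a R \<inter> G)"
    unfolding K_def B_def shift[OF QG] shift[OF BG] .
  moreover have "Q \<inter> G = {z \<in> cball a R \<inter> G. u z \<le> ereal (- s)}" by (auto simp: Q_def)
  ultimately show ?thesis by (simp add: M_def)
qed

text \<open>Finiteness lets the extended inequality pass to \<open>measure\<close>, which sends
  infinite values to 0. If \<open>measure M B\<close> is 0, the quotient is 0 by the convention for
  division.\<close>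

lemma measure_quotient_le:
  assumes le: "emeasure M A \<le> ennreal c * emeasure M B" and fin: "emeasure M B < \<infinity>" and c: "c \<ge> 0"
  shows "measure M A / measure M B \<le> c"
proof (cases "measure M B = 0")
  case False
  then have pos: "measure M B > 0" by (simp add: less_le)
  have "measure M A \<le> enn2real (ennreal c * emeasure M B)"
    unfolding measure_def using fin by (intro enn2real_mono le) (auto simp: ennreal_mult_less_top)
  also have "\<dots> = c * measure M B" using c by (simp add: enn2real_mult measure_def)
  finally show ?thesis using pos by (simp add: pos_divide_le_eq)
qed (use c in simp)

theorem theorem4p1:
  shows "(\<forall>(a :: complex ^ 'n) R u s.
            R > 0 \<longrightarrow> u \<in> lelong \<longrightarrow> has_max_on u (cball a R) 0 \<longrightarrow> s > 0 \<longrightarrow>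
            measure lborel {z \<in> cball a R. u z \<le> ereal (- s)} / measure lborel (cball a R)
              \<le> (4 ^ CARD('n) * (fact CARD('n))\<^sup>2 / fact (2 * CARD('n) - 1)) * exp (- 2 * s))
       \<and> (\<forall>(G :: (complex ^ 'n) set) m a R u s.
            subspace G \<longrightarrow> generic G \<longrightarrow> m = complex_dim G \<longrightarrow> m \<le> CARD('n) - 1 \<longrightarrow>
            a \<in> G \<longrightarrow> R > 0 \<longrightarrow> u \<in> lelong \<longrightarrow> has_max_on u (cball a R \<inter> G) 0 \<longrightarrow> s > 0 \<longrightarrow>
            measure (subspace_lebesgue G) {z \<in> cball a R \<inter> G. u z \<le> ereal (- s)}
                / measure (subspace_lebesgue G) (cball a R \<inter> G)
              \<le> 8 * real (CARD('n) + m) * exp (- s))"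
proof (intro conjI allI impI)
  fix a :: "complex ^ 'n" and R u s
  assume "R > 0" "u \<in> lelong" "has_max_on u (cball a R) 0" "s > (0::real)"
  then show "measure lborel {z \<in> cball a R. u z \<le> ereal (- s)} / measure lborel (cball a R)
      \<le> (4 ^ CARD('n) * (fact CARD('n))\<^sup>2 / fact (2 * CARD('n) - 1)) * exp (- 2 * s)"
    using emeasure_lborel_cball_finite[of a R]
    by (intro measure_quotient_le sublevel_volume_complex_ball) auto
next
  fix G :: "(complex ^ 'n) set" and m a R u s
  assume "subspace G" "generic G" "m = complex_dim G" "a \<in> G" "u \<in> lelong"
    "has_max_on u (cball a R \<inter> G) 0" "s > (0::real)"
  then show "measure (subspace_lebesgue G) {z \<in> cball a R \<inter> G. u z \<le> ereal (- s)}
      / measure (subspace_lebesgue G) (cball a R \<inter> G) \<le> 8 * real (CARD('n) + m) * exp (- s)"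
    using emeasure_subspace_lebesgue_bounded[of G "cball a R \<inter> G"] bounded_Int[of "cball a R" G]
    by (simp only:) (intro measure_quotient_le sublevel_volume_generic_ball; simp)
qed

end
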